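(* For all integers $k,l,m$ with $3\le k<l<m\le l+\frac{k-1}{2}$, $r(k,l,m)=k+2m-2$.
   Context: For a graph whose edges are coloured with red, blue and green, a red (resp. blue, green) $t$-connected matching is a connected component of the spanning subgraph formed by the red (resp. blue, green) edges whose maximum matching has size at least $t$. For positive integers $k,l,m$, $r(k,l,m)$ denotes the smallest integer $n$ such that every red-blue-green colouring of the edges of $K_{n,n}$ contains a red $k$-connected matching, or a blue $l$-connected matching, or a green $m$-connected matching. *)

theory Defs
  imports Complex_Main "HOL-Library.Disjoint_Sets"
begin

text \<open>A graph is a pair of a vertex set and a set of edges, an edge being the two-element set
  of its ends.\<close>

type_synonym 'a graph = "'a set \<times> 'a set set"

abbreviation verts :: "'a graph \<Rightarrow> 'a set" where
  "verts G \<equiv> fst G"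

abbreviation edges :: "'a graph \<Rightarrow> 'a set set" where
  "edges G \<equiv> snd G"

definition adjacency :: "'a graph \<Rightarrow> 'a rel" where
  "adjacency G = {(u, v). {u, v} \<in> edges G}"

definition joined_by_path :: "'a graph \<Rightarrow> 'a rel" where
  "joined_by_path G = {(u, v) \<in> verts G \<times> verts G. (u, v) \<in> (adjacency G)\<^sup>*}"

definition induced_subgraph :: "'a graph \<Rightarrow> 'a set \<Rightarrow> 'a graph" where
  "induced_subgraph G C = (C, {e \<in> edges G. e \<subseteq> C})"

definition components :: "'a graph \<Rightarrow> 'a graph set" where
  "components G = induced_subgraph G ` (verts G // joined_by_path G)"

definition matching :: "'a graph \<Rightarrow> 'a set set \<Rightarrow> bool" where
  "matching G M \<longleftrightarrow> M \<subseteq> edges G \<and> disjoint M"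

text \<open>Meaningful for graphs with finitely many edges only, as \<^term>\<open>Max\<close> is.\<close>

definition matching_number :: "'a graph \<Rightarrow> nat" where
  "matching_number G = Max {card M | M. matching G M}"

definition complete_bipartite :: "nat \<Rightarrow> nat \<Rightarrow> (nat + nat) graph" where
  "complete_bipartite a b =
     (Inl ` {..<a} \<union> Inr ` {..<b}, {{Inl i, Inr j} | i j. i < a \<and> j < b})"

datatype colour = Red | Blue | Green

text \<open>An edge colouring of \<open>G\<close> is a total function on vertex sets of which only the values on the
  edges of \<open>G\<close> are ever used.\<close>

definition colour_subgraph :: "'a graph \<Rightarrow> ('a set \<Rightarrow> colour) \<Rightarrow> colour \<Rightarrow> 'a graph" where
  "colour_subgraph G f c = (verts G, {e \<in> edges G. f e = c})"

definition connected_matching ::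
    "'a graph \<Rightarrow> ('a set \<Rightarrow> colour) \<Rightarrow> colour \<Rightarrow> nat \<Rightarrow> 'a graph \<Rightarrow> bool" where
  "connected_matching G f c t H \<longleftrightarrow>
     H \<in> components (colour_subgraph G f c) \<and> t \<le> matching_number H"

definition bipartite_ramsey_property :: "nat \<Rightarrow> nat \<Rightarrow> nat \<Rightarrow> nat \<Rightarrow> bool" where
  "bipartite_ramsey_property k l m n \<longleftrightarrow>
     (\<forall>f. (\<exists>H. connected_matching (complete_bipartite n n) f Red k H)
        \<or> (\<exists>H. connected_matching (complete_bipartite n n) f Blue l H)
        \<or> (\<exists>H. connected_matching (complete_bipartite n n) f Green m H))"

definition r :: "nat \<Rightarrow> nat \<Rightarrow> nat \<Rightarrow> nat" where
  "r k l m = (LEAST n. bipartite_ramsey_property k l m n)"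

end

theory Submission
  imports Defs
begin

text \<open>If a colouring of \<open>K\<^bsub>n,n\<^esub>\<close> with \<open>n = k + 2m - 2\<close> has no large connected matching, then by
  Koenig's theorem every red component has a vertex cover of size at most \<open>r = k - 1\<close> and every blue
  or green one a cover of size at most \<open>g = m - 1\<close>. Label each vertex, in each colour, by its component.
  Any row and any column then agree in some colour in which one of them is covered. As
  \<open>n > r + 2g\<close>, the covers of three components of different colours never exhaust a side; hence every
  vertex is covered in some colour.

  If two components of one colour contain a whole side, or two components of different colours contain
  all vertices, then essentially two covers per colour exhaust both sides, although their sizes add up to
  at most \<open>2(r + 2g) < 2n\<close>. Otherwise each colour has at least three labels on each side, and the
  label triples, being pairwise cross-agreeing, are forced to look like the rows of a Latin square of
  order 3; there a comparison of class sizes gives the contradiction.\<close>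

section \<open>Cover labellings\<close>

definition covered ::
    "('c \<Rightarrow> 'v \<Rightarrow> 'l) \<Rightarrow> ('c \<Rightarrow> 'v \<Rightarrow> bool) \<Rightarrow> 'v set \<Rightarrow> 'c \<Rightarrow> 'l \<Rightarrow> 'v set" where
  "covered lab cov S c i = {v \<in> S. lab c v = i \<and> cov c v}"

lemma colour_exhaust:
  fixes p q s d :: colour
  assumes "p \<noteq> q" "q \<noteq> s" "p \<noteq> s"
  shows "d = p \<or> d = q \<or> d = s"
  using assms by (cases p; cases q; cases s; cases d) auto

text \<open>Think of \<open>lab c v\<close> as the component of \<open>v\<close> in colour \<open>c\<close>, and of \<open>cov c v\<close> as membership of
  \<open>v\<close> in a fixed vertex cover of that component.\<close>

locale cover_labelling =
  fixes X Y :: "'v set" and lab :: "colour \<Rightarrow> 'v \<Rightarrow> 'l" and cov :: "colour \<Rightarrow> 'v \<Rightarrow> bool"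
    and t :: "colour \<Rightarrow> nat"
  assumes finX: "finite X" and finY: "finite Y" and card_eq: "card X = card Y"
    and dom: "x \<in> X \<Longrightarrow> y \<in> Y \<Longrightarrow> \<exists>c. lab c x = lab c y \<and> (cov c x \<or> cov c y)"
    and budget: "card (covered lab cov X c i) + card (covered lab cov Y c i) \<le> t c"
    and thr_le: "t Red \<le> t Green" and thr_eq: "t Blue = t Green"
    and thr_sum: "t Red + t Blue + t Green < card X"
begin

section \<open>Counting consequences of the cover budgets\<close>

abbreviation A where "A \<equiv> covered lab cov X"
abbreviation B where "B \<equiv> covered lab cov Y"

text \<open>All assumptions are symmetric in the two sides, so facts about \<open>X\<close> transfer
  to \<open>Y\<close>, later through the interpretation \<open>D\<close>.\<close>

lemma dual: "cover_labelling Y X lab cov t"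
proof
  show "\<exists>c. lab c x = lab c y \<and> (cov c x \<or> cov c y)" if "x \<in> Y" "y \<in> X" for x y
    using dom[OF that(2,1)] by metis
qed (use finX finY card_eq budget thr_le thr_eq thr_sum in \<open>auto simp: add.commute\<close>)

lemma finite_A [simp]: "finite (A c i)" and finite_B [simp]: "finite (B c i)"
  using finX finY by (auto simp: covered_def)

lemma card_A: "card (A c i) \<le> t c" and card_B: "card (B c i) \<le> t c"
  using budget[of c i] by auto

lemma thr_total: "p \<noteq> q \<Longrightarrow> q \<noteq> s \<Longrightarrow> p \<noteq> s \<Longrightarrow> t p + t q + t s = t Red + t Blue + t Green"
  by (cases p; cases q; cases s) auto

lemma thr_double: "t p + t p < card X"
  using thr_le thr_eq thr_sum by (cases p) auto

lemma ex_outside: "card S < card X \<Longrightarrow> finite S \<Longrightarrow> \<exists>x\<in>X. x \<notin> S"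
  by (meson card_mono leD subsetI)

lemma ex_uncovered2:
  assumes "p \<noteq> q" shows "\<exists>x\<in>X. x \<notin> A p i \<and> x \<notin> A q j"
proof -
  have "card (A p i \<union> A q j) \<le> card (A p i) + card (A q j)" by (rule card_Un_le)
  also have "\<dots> \<le> t p + t q" using card_A by (simp add: add_mono)
  also have "\<dots> < card X"
    using assms thr_sum by (cases p; cases q) auto
  finally show ?thesis using ex_outside[of "A p i \<union> A q j"] by auto
qed

lemma ex_uncovered3:
  assumes "p \<noteq> q" "q \<noteq> s" "p \<noteq> s"
  shows "\<exists>x\<in>X. x \<notin> A p i \<and> x \<notin> A q j \<and> x \<notin> A s k"
proof -
  have "card (A p i \<union> A q j \<union> A s k) \<le> card (A p i) + card (A q j) + card (A s k)"
    by (meson add_mono_thms_linordered_semiring(3) card_Un_le order_trans)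
  also have "\<dots> \<le> t p + t q + t s" by (intro add_mono card_A)
  also have "\<dots> < card X" using thr_total[OF assms] thr_sum by simp
  finally show ?thesis using ex_outside[of "A p i \<union> A q j \<union> A s k"] by auto
qed

text \<open>Take \<open>x\<close> outside the covers of the three components of \<open>y\<close>. It
  agrees with \<open>y\<close> in a colour where one of the two is covered, and this cannot be
  \<open>x\<close>.\<close>

lemma ex_cov:
  assumes "y \<in> Y" shows "\<exists>c. cov c y"
proof -
  obtain x where x: "x \<in> X" "x \<notin> A Red (lab Red y)" "x \<notin> A Blue (lab Blue y)" "x \<notin> A Green (lab Green y)"
    using ex_uncovered3[of Red Blue Green "lab Red y" "lab Blue y" "lab Green y"] by auto
  obtain c where "lab c x = lab c y" "cov c x \<or> cov c y" using dom[OF x(1) assms] by auto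
  with x show ?thesis by (cases c) (auto simp: covered_def)
qed

text \<open>One \<open>x\<close> outside the two covers serves all these \<open>y\<close>: agreement
  in \<open>p\<close> or \<open>q\<close> would need a covered vertex, so each \<open>y\<close> has
  the \<open>s\<close>-label of \<open>x\<close>.\<close>

lemma pivot:
  assumes "p \<noteq> q" "q \<noteq> s" "p \<noteq> s"
  shows "\<exists>k. \<forall>y\<in>Y. lab p y = i \<longrightarrow> lab q y = j \<longrightarrow> \<not> cov p y \<longrightarrow> \<not> cov q y \<longrightarrow> lab s y = k \<and> cov s y"
proof -
  obtain x where x: "x \<in> X" "x \<notin> A p i" "x \<notin> A q j" using ex_uncovered2[OF assms(1)] by blast
  have "lab s y = lab s x \<and> cov s y"
    if y: "y \<in> Y" "lab p y = i" "lab q y = j" "\<not> cov p y" "\<not> cov q y" for y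
  proof
    obtain c where "lab c x = lab c y" "cov c x \<or> cov c y" using dom[OF x(1) y(1)] by auto
    then show "lab s y = lab s x" using x y colour_exhaust[OF assms, of c] by (auto simp: covered_def)
    show "cov s y" using ex_cov[OF y(1)] y colour_exhaust[OF assms] by metis
  qed
  then show ?thesis by blast
qed

lemma card_Un6_le:
  "card (A1 \<union> A2 \<union> A3 \<union> A4 \<union> A5 \<union> A6)
    \<le> card A1 + card A2 + card A3 + card A4 + card A5 + card A6"
  by (intro order.trans[OF card_Un_le] add_mono order.refl)

lemma card_le6:
  assumes "S \<subseteq> A1 \<union> A2 \<union> A3 \<union> A4 \<union> A5 \<union> A6"
    "finite A1" "finite A2" "finite A3" "finite A4" "finite A5" "finite A6"
  shows "card S \<le> card A1 + card A2 + card A3 + card A4 + card A5 + card A6"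
  using card_mono[OF _ assms(1)] assms(2-) card_Un6_le order.trans by blast

text \<open>The budget bounds each cover over both sides together, so six such covers have total
  size at most twice the sum of the thresholds, less than \<open>card X + card Y\<close>.\<close>

lemma six_labels:
  assumes "p \<noteq> q" "q \<noteq> s" "p \<noteq> s"
    and "X \<subseteq> A p i1 \<union> A p i2 \<union> A q j1 \<union> A q j2 \<union> A s k1 \<union> A s k2"
    and "Y \<subseteq> B p i1 \<union> B p i2 \<union> B q j1 \<union> B q j2 \<union> B s k1 \<union> B s k2"
  shows False
  using card_le6[OF assms(4)] card_le6[OF assms(5)] thr_total[OF assms(1-3)] thr_sum card_eq
    budget[of p i1] budget[of p i2] budget[of q j1] budget[of q j2] budget[of s k1] budget[of s k2]
  by simp

end

section \<open>Two components of one colour\<close>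

text \<open>With \<open>(f, g)\<close> as grid coordinates, every point of \<open>X\<close> shares a
  line with every point of \<open>Y\<close>. If neither side lies on a line, the sides occupy the
  two diagonals of one rectangle.\<close>

lemma two_label_structure:
  assumes "\<forall>x\<in>X. \<forall>y\<in>Y. f x = f y \<or> g x = g y"
  obtains i where "\<forall>x\<in>X. f x = i" | i where "\<forall>x\<in>X. g x = i"
    | i where "\<forall>y\<in>Y. f y = i" | i where "\<forall>y\<in>Y. g y = i"
    | a b c d where "\<forall>x\<in>X. f x = a \<and> g x = b \<or> f x = c \<and> g x = d"
        "\<forall>y\<in>Y. f y = a \<and> g y = d \<or> f y = c \<and> g y = b"
proof (cases "(\<exists>i. \<forall>x\<in>X. f x = i) \<or> (\<exists>i. \<forall>x\<in>X. g x = i) \<or> (\<exists>i. \<forall>y\<in>Y. f y = i) \<or> (\<exists>i. \<forall>y\<in>Y. g y = i)")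
  case True
  then show thesis using that(1-4) by metis
next
  case False
  have *: "\<exists>u\<in>S. \<exists>v\<in>S. f u \<noteq> f v \<and> g u \<noteq> g v"
    if "\<nexists>i. \<forall>x\<in>S. f x = i" "\<nexists>i. \<forall>x\<in>S. g x = i" for S
    using that by metis
  obtain u v where uv: "u \<in> X" "v \<in> X" "f u \<noteq> f v" "g u \<noteq> g v" using *[of X] False by blast
  obtain w z where wz: "w \<in> Y" "z \<in> Y" "f w \<noteq> f z" "g w \<noteq> g z" using *[of Y] False by blast
  have Y: "f y = f u \<and> g y = g v \<or> f y = f v \<and> g y = g u" if "y \<in> Y" for y
    using assms uv that by metis
  have "f x = f u \<and> g x = g u \<or> f x = f v \<and> g x = g v" if "x \<in> X" for x
    using assms uv wz that Y[OF wz(1)] Y[OF wz(2)] by metis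
  with Y show thesis using that(5)[of "f u" "g u" "f v" "g v"] by blast
qed

context cover_labelling
begin

section \<open>A colour with two labels in all, whose covers on \<open>Y\<close> fit into one
  threshold\<close>

context
  fixes p q s :: colour and i1 i2 :: 'l
  assumes distinct: "p \<noteq> q" "q \<noteq> s" "p \<noteq> s"
    and two: "\<forall>v\<in>X \<union> Y. lab p v = i1 \<or> lab p v = i2"
    and small: "card (B p i1) + card (B p i2) \<le> t p"
begin

lemma A_p: "x \<in> X \<Longrightarrow> cov p x \<Longrightarrow> x \<in> A p i1 \<union> A p i2"
  and B_p: "y \<in> Y \<Longrightarrow> cov p y \<Longrightarrow> y \<in> B p i1 \<union> B p i2"
  using two by (auto simp: covered_def)

lemma not_Y_subset: "\<not> Y \<subseteq> B p i1 \<union> B p i2 \<union> B q j \<union> B s k"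
proof
  assume "Y \<subseteq> B p i1 \<union> B p i2 \<union> B q j \<union> B s k"
  then have "card Y \<le> card (B p i1) + card (B p i2) + card (B q j) + card (B s k)"
    using card_le6[of Y "B p i1" "B p i2" "B q j" "B s k" "{}" "{}"] by simp
  also have "\<dots> \<le> t p + t q + t s" using small card_B[of q j] card_B[of s k] by simp
  finally show False using thr_total[OF distinct] thr_sum card_eq by simp
qed

lemma dom_uncovered:
  assumes "x \<in> X" "y \<in> Y" "\<not> cov p x" "\<not> cov p y"
  shows "lab q x = lab q y \<and> (cov q x \<or> cov q y) \<or> lab s x = lab s y \<and> (cov s x \<or> cov s y)"
proof -
  obtain c where "lab c x = lab c y" "cov c x \<or> cov c y" using dom[OF assms(1,2)] by auto
  then show ?thesis using colour_exhaust[OF distinct, of c] assms by auto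
qed

text \<open>Two pivots complete the covers of \<open>Y\<close>. Either the same labels exhaust
  \<open>X\<close>, or some leftover \<open>x\<close> fixes the \<open>s\<close>-label, and then
  four covers exhaust \<open>Y\<close>, where \<open>small\<close> lets the two in colour
  \<open>p\<close> count as one.\<close>

lemma Y_line:
  assumes line: "\<forall>y\<in>Y. \<not> cov p y \<longrightarrow> lab q y = j"
  shows False
proof -
  obtain k1 where k1: "\<forall>y\<in>Y. lab p y = i1 \<longrightarrow> lab q y = j \<longrightarrow> \<not> cov p y \<longrightarrow> \<not> cov q y \<longrightarrow> lab s y = k1 \<and> cov s y"
    using pivot[OF distinct] by blast
  obtain k2 where k2: "\<forall>y\<in>Y. lab p y = i2 \<longrightarrow> lab q y = j \<longrightarrow> \<not> cov p y \<longrightarrow> \<not> cov q y \<longrightarrow> lab s y = k2 \<and> cov s y"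
    using pivot[OF distinct] by blast
  have Y: "Y \<subseteq> B p i1 \<union> B p i2 \<union> B q j \<union> B q j \<union> B s k1 \<union> B s k2"
    using B_p k1 k2 line two by (fastforce simp: covered_def)
  show False
  proof (cases "\<exists>x\<in>X. \<not> cov p x \<and> \<not> (lab q x = j \<and> cov q x)")
    case True
    then obtain x where x: "x \<in> X" "\<not> cov p x" "\<not> (lab q x = j \<and> cov q x)" by blast
    have "y \<in> B p i1 \<union> B p i2 \<union> B q j \<union> B s (lab s x)" if y: "y \<in> Y" for y
    proof (cases "cov p y \<or> cov q y")
      case True
      then show ?thesis using B_p y line by (auto simp: covered_def)
    next
      case False
      then have "lab s x = lab s y" using dom_uncovered[OF x(1) y x(2)] x line y by auto
      moreover have "cov s y" using False k1 k2 line two y by auto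
      ultimately show ?thesis using y by (auto simp: covered_def)
    qed
    then show False using not_Y_subset by blast
  next
    case False
    then have "X \<subseteq> A p i1 \<union> A p i2 \<union> A q j \<union> A q j \<union> A s k1 \<union> A s k2"
      using A_p by (auto simp: covered_def)
    then show False using six_labels[OF distinct _ Y] by blast
  qed
qed

text \<open>The bound \<open>small\<close> says nothing about \<open>X\<close>, so the covers of
  both sides are counted. Three covers of one colour may occur; the order of the thresholds decides
  whether \<open>X\<close> alone or both sides together give the contradiction.\<close>

lemma X_line:
  assumes line: "\<forall>x\<in>X. \<not> cov p x \<longrightarrow> lab q x = j"
  shows False
proof (cases "\<exists>x\<in>X. \<not> cov p x \<and> \<not> cov q x")
  case True
  then obtain x0 where x0: "x0 \<in> X" "\<not> cov p x0" "\<not> cov q x0" by blast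
  define k where "k = lab s x0"
  have k: "lab s y = k" if "y \<in> Y" "\<not> cov p y" "\<not> (lab q y = j \<and> cov q y)" for y
    using dom_uncovered[OF x0(1) that(1) x0(2) that(2)] that x0 line unfolding k_def by auto
  \<comment> \<open>Only colour \<open>q\<close> is left to cover \<open>y0\<close>, with a label
    other than \<open>j\<close>; so every \<open>x\<close> uncovered in \<open>p\<close> must meet
    \<open>y0\<close> in \<open>s\<close>.\<close>
  obtain y0 where y0: "y0 \<in> Y" "\<not> cov p y0" "\<not> (lab q y0 = j \<and> cov q y0)" "\<not> cov s y0"
    using not_Y_subset[of j k] B_p k by (auto simp: covered_def)
  then have "cov q y0" using ex_cov[of y0] colour_exhaust[OF distinct] by metis
  with y0 have "lab q y0 \<noteq> j" by auto
  then have "lab s x = k \<and> cov s x" if "x \<in> X" "\<not> cov p x" for x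
    using dom_uncovered[OF that(1) y0(1) that(2) y0(2)] that line y0 k[OF y0(1-3)] by auto
  then have X: "X \<subseteq> A p i1 \<union> A p i2 \<union> A s k \<union> {} \<union> {} \<union> {}"
    using A_p by (auto simp: covered_def)
  obtain j1 where j1: "\<forall>y\<in>Y. lab p y = i1 \<longrightarrow> lab s y = k \<longrightarrow> \<not> cov p y \<longrightarrow> \<not> cov s y \<longrightarrow> lab q y = j1 \<and> cov q y"
    using pivot[of p s q] distinct by blast
  obtain j2 where j2: "\<forall>y\<in>Y. lab p y = i2 \<longrightarrow> lab s y = k \<longrightarrow> \<not> cov p y \<longrightarrow> \<not> cov s y \<longrightarrow> lab q y = j2 \<and> cov q y"
    using pivot[of p s q] distinct by blast
  have Y: "Y \<subseteq> B p i1 \<union> B p i2 \<union> B s k \<union> B q j \<union> B q j1 \<union> B q j2"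
  proof
    fix y assume y: "y \<in> Y"
    show "y \<in> B p i1 \<union> B p i2 \<union> B s k \<union> B q j \<union> B q j1 \<union> B q j2"
      using B_p[OF y] k[OF y] j1 j2 two y by (fastforce simp: covered_def)
  qed
  \<comment> \<open>If \<open>s\<close> is \<open>Red\<close>, the covers of \<open>X\<close> alone
    are too small. Otherwise \<open>t q\<close> is at most \<open>t s\<close>, and three
    \<open>q\<close>-covers on \<open>Y\<close> still leave the total below
    \<open>2 * card X\<close>.\<close>
  show False
    using card_le6[OF X] card_le6[OF Y] budget[of p i1] budget[of p i2] budget[of s k] card_B[of q j]
      card_B[of q j1] card_B[of q j2] thr_le thr_eq thr_sum card_eq distinct
    by (cases p; cases q; cases s) simp_all
next
  case False
  then have X: "X \<subseteq> A p i1 \<union> A p i2 \<union> A q j \<union> {} \<union> {} \<union> {}"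
    using A_p line by (auto simp: covered_def)
  have nX: "card X \<le> t p + t p + t q"
    using card_le6[OF X] card_A[of p i1] card_A[of p i2] card_A[of q j] by simp
  obtain k1 where k1: "\<forall>y\<in>Y. lab p y = i1 \<longrightarrow> lab q y = j \<longrightarrow> \<not> cov p y \<longrightarrow> \<not> cov q y \<longrightarrow> lab s y = k1 \<and> cov s y"
    using pivot[OF distinct] by blast
  obtain k2 where k2: "\<forall>y\<in>Y. lab p y = i2 \<longrightarrow> lab q y = j \<longrightarrow> \<not> cov p y \<longrightarrow> \<not> cov q y \<longrightarrow> lab s y = k2 \<and> cov s y"
    using pivot[OF distinct] by blast
  have "card (A p i1 \<union> A p i2) < card X"
    using card_Un_le[of "A p i1" "A p i2"] card_A[of p i1] card_A[of p i2] thr_double[of p] by linarith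
  then have "\<exists>x\<in>X. x \<notin> A p i1 \<union> A p i2" by (rule ex_outside) simp
  then obtain x0 where x0: "x0 \<in> X" "\<not> cov p x0" using A_p by blast
  define k where "k = lab s x0"
  have k: "lab s y = k" if "y \<in> Y" "\<not> cov p y" "lab q y \<noteq> j" for y
    using dom_uncovered[OF x0(1) that(1) x0(2) that(2)] that x0 line unfolding k_def by auto
  show False
  proof (cases "\<exists>y\<in>Y. \<not> cov p y \<and> lab q y \<noteq> j \<and> \<not> cov s y")
    case True
    then obtain y1 where y1: "y1 \<in> Y" "\<not> cov p y1" "lab q y1 \<noteq> j" "\<not> cov s y1" by blast
    then have "lab s x = k \<and> cov s x" if "x \<in> X" "\<not> cov p x" for x
      using dom_uncovered[OF that(1) y1(1) that(2) y1(2)] that line y1 k[OF y1(1-3)] by auto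
    then have X: "X \<subseteq> A p i1 \<union> A p i2 \<union> A s k \<union> {} \<union> {} \<union> {}"
      using A_p by (auto simp: covered_def)
    \<comment> \<open>\<open>X\<close> lies in two \<open>p\<close>-covers with one
      \<open>q\<close>-cover and also in two \<open>p\<close>-covers with one
      \<open>s\<close>-cover; one of these unions has size at most
      \<open>t Red + t Blue + t Green\<close>.\<close>
    then show False
      using nX card_le6[OF X] card_A[of p i1] card_A[of p i2] card_A[of s k] distinct
        thr_le thr_eq thr_sum by (cases p; cases q; cases s) simp_all
  next
    case False
    have Y: "Y \<subseteq> B p i1 \<union> B p i2 \<union> B q j \<union> B s k \<union> B s k1 \<union> B s k2"
    proof
      fix y assume y: "y \<in> Y"
      show "y \<in> B p i1 \<union> B p i2 \<union> B q j \<union> B s k \<union> B s k1 \<union> B s k2"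
        using B_p[OF y] k[OF y] k1 k2 two y False by (fastforce simp: covered_def)
    qed
    show False
      using nX card_le6[OF X] card_le6[OF Y] budget[of p i1] budget[of p i2] budget[of q j] card_B[of s k]
        card_B[of s k1] card_B[of s k2] thr_le thr_eq thr_sum card_eq distinct
      by (cases p; cases q; cases s) simp_all
  qed
qed

end

text \<open>Vertices uncovered in \<open>p\<close> can meet only through \<open>q\<close> and
  \<open>s\<close>, so \<open>two_label_structure\<close> applies to them. The line cases are
  excluded above, and the rectangle case leaves two labels per colour.\<close>

lemma two_labels_small:
  assumes distinct: "p \<noteq> q" "q \<noteq> s" "p \<noteq> s"
    and two: "\<forall>v\<in>X \<union> Y. lab p v = i1 \<or> lab p v = i2"
    and small: "card (B p i1) + card (B p i2) \<le> t p"
  shows False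
proof -
  have distinct': "p \<noteq> s" "s \<noteq> q" "p \<noteq> q" using distinct by auto
  have "\<forall>x\<in>{x\<in>X. \<not> cov p x}. \<forall>y\<in>{y\<in>Y. \<not> cov p y}. lab q x = lab q y \<or> lab s x = lab s y"
    using dom_uncovered[OF distinct two small] by blast
  then show False
  proof (cases rule: two_label_structure)
    case (1 i) then show False using X_line[OF distinct two small] by blast
  next
    case (2 i) then show False using X_line[OF distinct' two small] by blast
  next
    case (3 i) then show False using Y_line[OF distinct two small] by blast
  next
    case (4 i) then show False using Y_line[OF distinct' two small] by blast
  next
    case (5 a b c d)
    interpret D: cover_labelling Y X lab cov t by (rule dual)
    have "X \<subseteq> A p i1 \<union> A p i2 \<union> A q a \<union> A q c \<union> A s b \<union> A s d"
    proof
      fix x assume x: "x \<in> X"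
      obtain e where "cov e x" using D.ex_cov[OF x] by blast
      then show "x \<in> A p i1 \<union> A p i2 \<union> A q a \<union> A q c \<union> A s b \<union> A s d"
        using x 5(1) A_p[OF distinct two small x] colour_exhaust[OF distinct, of e] by (auto simp: covered_def)
    qed
    moreover have "Y \<subseteq> B p i1 \<union> B p i2 \<union> B q a \<union> B q c \<union> B s b \<union> B s d"
    proof
      fix y assume y: "y \<in> Y"
      obtain e where "cov e y" using ex_cov[OF y] by blast
      then show "y \<in> B p i1 \<union> B p i2 \<union> B q a \<union> B q c \<union> B s b \<union> B s d"
        using y 5(2) B_p[OF distinct two small y] colour_exhaust[OF distinct, of e] by (auto simp: covered_def)
    qed
    ultimately show False using six_labels[OF distinct] by blast
  qed
qed

text \<open>The two budgets in colour \<open>p\<close> sum to at most \<open>2 * t p\<close>, so one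
  side carries at most \<open>t p\<close>; \<open>dual\<close> makes it \<open>Y\<close>.\<close>

lemma two_labels:
  assumes "\<forall>v\<in>X \<union> Y. lab p v = i1 \<or> lab p v = i2"
  shows False
proof -
  interpret D: cover_labelling Y X lab cov t by (rule dual)
  obtain q s where distinct: "p \<noteq> q" "q \<noteq> s" "p \<noteq> s" by (cases p) blast+
  have "card (B p i1) + card (B p i2) \<le> t p \<or> card (A p i1) + card (A p i2) \<le> t p"
    using budget[of p i1] budget[of p i2] by linarith
  then show False
    using two_labels_small[OF distinct assms] D.two_labels_small[OF distinct] assms by blast
qed

text \<open>A vertex of \<open>Y\<close> with a \<open>p\<close>-label foreign to \<open>X\<close>
  never meets \<open>X\<close> in \<open>p\<close>. Relabelling it \<open>i1\<close> and uncovering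
  it in \<open>p\<close> preserves all assumptions.\<close>

lemma two_labels_X:
  assumes "\<forall>x\<in>X. lab p x = i1 \<or> lab p x = i2"
  shows False
proof -
  define out where "out v \<longleftrightarrow> lab p v \<noteq> i1 \<and> lab p v \<noteq> i2" for v
  define lab' where "lab' c v = (if c = p \<and> out v then i1 else lab c v)" for c v
  define cov' where "cov' c v \<longleftrightarrow> cov c v \<and> \<not> (c = p \<and> out v)" for c v
  have sub: "covered lab' cov' S c i \<subseteq> covered lab cov S c i" for S c i
    by (auto simp: covered_def lab'_def cov'_def)
  interpret R: cover_labelling X Y lab' cov' t
  proof
    show "\<exists>c. lab' c x = lab' c y \<and> (cov' c x \<or> cov' c y)" if xy: "x \<in> X" "y \<in> Y" for x y
    proof -
      obtain c where "lab c x = lab c y" "cov c x \<or> cov c y" using dom[OF xy] by auto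
      then show ?thesis using assms xy(1) by (intro exI[of _ c]) (auto simp: lab'_def cov'_def out_def)
    qed
    show "card (covered lab' cov' X c i) + card (covered lab' cov' Y c i) \<le> t c" for c i
      using budget[of c i] card_mono[OF finite_A sub] card_mono[OF finite_B sub] add_mono order.trans
      by meson
  qed (use finX finY card_eq thr_le thr_eq thr_sum in auto)
  show False by (rule R.two_labels[of p i1 i2]) (auto simp: lab'_def out_def)
qed

end

section \<open>Two components of different colours\<close>

context cover_labelling
begin

lemma third_label_X: "\<exists>x\<in>X. lab c x \<noteq> i \<and> lab c x \<noteq> j"
  using two_labels_X[of c i j] by blast

lemma third_label_Y: "\<exists>y\<in>Y. lab c y \<noteq> i \<and> lab c y \<noteq> j"
proof -
  interpret D: cover_labelling Y X lab cov t by (rule dual)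
  show ?thesis by (rule D.third_label_X)
qed

text \<open>Outside \<open>k\<close> the \<open>p\<close>-label is \<open>i\<close> and the
  \<open>q\<close>-label is fixed on each side, so \<open>pivot\<close> gives one
  \<open>s\<close>-label per side. They coincide, because vertices uncovered in \<open>p\<close> and
  \<open>q\<close> can only meet in \<open>s\<close>.\<close>

lemma common_label:
  assumes distinct: "p \<noteq> q" "q \<noteq> s" "p \<noteq> s"
    and two: "\<forall>v\<in>X \<union> Y. lab p v = i \<or> lab s v = k"
    and X: "\<forall>x\<in>X. lab s x \<noteq> k \<longrightarrow> lab q x = j1"
    and Y: "\<forall>y\<in>Y. lab s y \<noteq> k \<longrightarrow> lab q y = j2"
  shows "\<exists>l. \<forall>v\<in>X \<union> Y. lab s v \<noteq> k \<longrightarrow> \<not> cov p v \<longrightarrow> \<not> cov q v \<longrightarrow> lab s v = l \<and> cov s v"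
proof -
  interpret D: cover_labelling Y X lab cov t by (rule dual)
  define rest where "rest v \<longleftrightarrow> lab s v \<noteq> k \<and> \<not> cov p v \<and> \<not> cov q v" for v
  have cov: "cov s v" if v: "v \<in> X \<union> Y" "rest v" for v
  proof -
    obtain e where "cov e v" using v(1) ex_cov D.ex_cov by blast
    then show ?thesis using v(2) colour_exhaust[OF distinct, of e] unfolding rest_def by auto
  qed
  obtain l1 where l1: "\<forall>x\<in>X. rest x \<longrightarrow> lab s x = l1"
    using D.pivot[OF distinct, of i j1] X two unfolding rest_def by (metis UnI1)
  obtain l2 where l2: "\<forall>y\<in>Y. rest y \<longrightarrow> lab s y = l2"
    using pivot[OF distinct, of i j2] Y two unfolding rest_def by (metis UnI2)
  have "lab s x = lab s y" if xy: "x \<in> X" "y \<in> Y" "rest x" "rest y" for x y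
  proof -
    obtain c where "lab c x = lab c y" "cov c x \<or> cov c y" using dom[OF xy(1,2)] by auto
    then show ?thesis using xy(3,4) colour_exhaust[OF distinct, of c] unfolding rest_def by auto
  qed
  then have "\<exists>l. \<forall>v\<in>X \<union> Y. rest v \<longrightarrow> lab s v = l"
    using l1 l2 by (metis Un_iff)
  with cov show ?thesis unfolding rest_def by blast
qed

text \<open>A vertex outside \<open>i\<close> has \<open>s\<close>-label \<open>k\<close>, one
  outside \<open>k\<close> has \<open>p\<close>-label \<open>i\<close>, so across the sides they
  meet only in \<open>q\<close>. This ties the \<open>q\<close>-labels to \<open>j1\<close> and
  \<open>j2\<close>; with one further label in each of \<open>p\<close> and \<open>s\<close>, six
  covers exhaust both sides.\<close>

lemma two_colours:
  assumes neq: "p \<noteq> s" and two: "\<forall>v\<in>X \<union> Y. lab p v = i \<or> lab s v = k"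
  shows False
proof -
  interpret D: cover_labelling Y X lab cov t by (rule dual)
  obtain q where distinct: "p \<noteq> q" "q \<noteq> s" "p \<noteq> s" using neq by (cases p; cases s) blast+
  have only: "lab q x = lab q y"
    if xy: "x \<in> X" "y \<in> Y" "lab p x \<noteq> i \<and> lab s y \<noteq> k \<or> lab s x \<noteq> k \<and> lab p y \<noteq> i" for x y
  proof -
    obtain c where "lab c x = lab c y" using dom[OF xy(1,2)] by auto
    moreover have "lab p x = i \<or> lab s x = k" "lab p y = i \<or> lab s y = k" using two xy(1,2) by auto
    ultimately show ?thesis using xy(3) colour_exhaust[OF distinct, of c] by auto
  qed
  obtain x1 where x1: "x1 \<in> X" "lab s x1 \<noteq> k" using third_label_X by blast
  obtain x2 where x2: "x2 \<in> X" "lab p x2 \<noteq> i" using third_label_X by blast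
  obtain y1 where y1: "y1 \<in> Y" "lab p y1 \<noteq> i" using third_label_Y by blast
  obtain y2 where y2: "y2 \<in> Y" "lab s y2 \<noteq> k" using third_label_Y by blast
  define j1 j2 where "j1 = lab q y1" and "j2 = lab q y2"
  have Xs: "\<forall>x\<in>X. lab s x \<noteq> k \<longrightarrow> lab q x = j1" and Xp: "\<forall>x\<in>X. lab p x \<noteq> i \<longrightarrow> lab q x = j2"
    using only y1 y2 unfolding j1_def j2_def by blast+
  have Yp: "\<forall>y\<in>Y. lab p y \<noteq> i \<longrightarrow> lab q y = j1" and Ys: "\<forall>y\<in>Y. lab s y \<noteq> k \<longrightarrow> lab q y = j2"
    using only x1 x2 Xs Xp by metis+
  obtain l where l: "\<forall>v\<in>X \<union> Y. lab s v \<noteq> k \<longrightarrow> \<not> cov p v \<longrightarrow> \<not> cov q v \<longrightarrow> lab s v = l \<and> cov s v"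
    using common_label[OF distinct two Xs Ys] by blast
  have two': "\<forall>v\<in>X \<union> Y. lab s v = k \<or> lab p v = i" using two by blast
  obtain h where h: "\<forall>v\<in>X \<union> Y. lab p v \<noteq> i \<longrightarrow> \<not> cov s v \<longrightarrow> \<not> cov q v \<longrightarrow> lab p v = h \<and> cov p v"
    using common_label[OF _ _ _ two' Xp Yp] distinct by blast
  \<comment> \<open>With any other \<open>q\<close>-label, \<open>x\<close> would have labels
    \<open>i\<close> and \<open>k\<close> and force all of \<open>Y\<close> into three covers of
    different colours.\<close>
  have XQ: "lab q x = j1 \<or> lab q x = j2" if x: "x \<in> X" "\<not> cov p x" "\<not> cov s x" for x
  proof (rule ccontr)
    assume neg: "\<not> (lab q x = j1 \<or> lab q x = j2)"
    have "y \<in> B p i \<union> B s k \<union> B q (lab q x)" if y: "y \<in> Y" for y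
    proof -
      obtain c where c: "lab c x = lab c y" "cov c x \<or> cov c y" using dom[OF x(1) y] by auto
      have "lab p x = i" "lab s x = k" using neg x Xs Xp by blast+
      then have "cov p y \<and> lab p y = i \<or> cov s y \<and> lab s y = k \<or> lab q y = lab q x"
        using c x colour_exhaust[OF distinct, of c] by auto
      moreover have "cov p y \<or> cov s y \<or> cov q y" using ex_cov[OF y] colour_exhaust[OF distinct] by metis
      moreover have "lab p y = i \<and> lab s y = k" if "lab q y = lab q x"
        using neg Yp Ys y that by metis
      ultimately show ?thesis using y by (auto simp: covered_def)
    qed
    then show False using D.ex_uncovered3[of p s q] distinct by blast
  qed
  have YQ: "lab q y = j1 \<or> lab q y = j2" if y: "y \<in> Y" "\<not> cov p y" "\<not> cov s y" for y
  proof (rule ccontr)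
    assume neg: "\<not> (lab q y = j1 \<or> lab q y = j2)"
    have "x \<in> A p i \<union> A s k \<union> A q (lab q y)" if x: "x \<in> X" for x
    proof -
      obtain c where c: "lab c x = lab c y" "cov c x \<or> cov c y" using dom[OF x y(1)] by auto
      have "lab p y = i" "lab s y = k" using neg y Ys Yp by blast+
      then have "cov p x \<and> lab p x = i \<or> cov s x \<and> lab s x = k \<or> lab q x = lab q y"
        using c y colour_exhaust[OF distinct, of c] by auto
      moreover have "cov p x \<or> cov s x \<or> cov q x" using D.ex_cov[OF x] colour_exhaust[OF distinct] by metis
      moreover have "lab p x = i \<and> lab s x = k" if "lab q x = lab q y"
        using neg Xp Xs x that by metis
      ultimately show ?thesis using x by (auto simp: covered_def)
    qed
    then show False using ex_uncovered3[of p s q] distinct by blast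
  qed
  have all: "cov p v \<and> (lab p v = i \<or> lab p v = h) \<or> cov s v \<and> (lab s v = k \<or> lab s v = l)
      \<or> cov q v \<and> (lab q v = j1 \<or> lab q v = j2)" if v: "v \<in> X \<union> Y" for v
  proof -
    have Q: "lab p v \<noteq> i \<or> lab s v \<noteq> k \<or> \<not> cov p v \<and> \<not> cov s v \<Longrightarrow> lab q v = j1 \<or> lab q v = j2"
      using v Xs Xp Ys Yp XQ YQ by blast
    obtain e where "cov e v" using v ex_cov D.ex_cov by blast
    then have "cov p v \<or> cov s v \<or> cov q v" using colour_exhaust[OF distinct, of e] by auto
    then show ?thesis using Q bspec[OF h v] bspec[OF l v] bspec[OF two v] by argo
  qed
  have "X \<subseteq> A p i \<union> A p h \<union> A q j1 \<union> A q j2 \<union> A s k \<union> A s l"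
    using all by (fastforce simp: covered_def)
  moreover have "Y \<subseteq> B p i \<union> B p h \<union> B q j1 \<union> B q j2 \<union> B s k \<union> B s l"
    using all by (fastforce simp: covered_def)
  ultimately show False using six_labels[OF distinct] by blast
qed

end

section \<open>Label triples forming a Latin square\<close>

text \<open>Here \<open>xo\<close>, \<open>yo\<close> count vertices of one reference type, and
  \<open>xi\<close>, \<open>yi\<close> those sharing with it only the label in colour
  \<open>i\<close>; \<open>aj\<close>, \<open>bj\<close> are cover sizes. \<open>F\<close> and
  \<open>G\<close> come from sets that meet only in their own colour, \<open>E\<close> from classes
  of different index, which meet in the remaining colour.\<close>

lemma latin_arith_step:
  fixes n r g :: nat
  assumes thr: "r \<le> g" "ti = r \<and> tj = g \<and> tk = g \<or> ti = g \<and> tj = r \<and> tk = g \<or> ti = g \<and> tj = g \<and> tk = r"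
    and n: "r + g + g < n" "n \<le> xo + xi + xj + xk" "n \<le> yo + yi + yj + yk"
    and bud: "bi \<le> ti" "aj \<le> tj" "bj \<le> tj" "ak \<le> tk" "bk \<le> tk"
    and F: "xj \<le> aj \<or> yo + yj \<le> bj"
    and G: "xo + xj \<le> aj \<or> yj \<le> bj" "xo + xk \<le> ak \<or> yk \<le> bk"
    and E: "xi \<le> tk \<or> yj \<le> tk" "xk \<le> ti \<or> yj \<le> ti" "xj \<le> ti \<or> yk \<le> ti" "xj \<le> tk \<or> yi \<le> tk"
    and i: "yo + yi \<le> bi" and j: "tk < yj"
  shows False
proof -
  have xi: "xi \<le> tk" using E(1) j by linarith
  \<comment> \<open>Either alternative makes \<open>k\<close> the colour of the small threshold
    \<open>r\<close>.\<close>
  from G(1) show False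
  proof
    assume h: "xo + xj \<le> aj"
    then have "ti < xk" using n xi bud thr by linarith
    then have yj: "yj \<le> ti" using E(2) by linarith
    with j thr(2) have tk: "tk = r" "ti = g" "tj = g" using thr(1) by auto
    then have "\<not> xo + xk \<le> ak" using bud \<open>ti < xk\<close> thr(1) by linarith
    then have "yk \<le> bk" using G(2) by blast
    then show False using n yj i bud tk by linarith
  next
    assume h: "yj \<le> bj"
    with j bud(3) thr have tk: "tk = r" "ti = g" "tj = g" by auto
    then have yk: "r < yk" using n i h bud by linarith
    then have xk: "xo + xk \<le> ak" using G(2) bud tk by linarith
    then have "g < xj" using n xi tk bud thr(1) by linarith
    then have "yk \<le> g" "yi \<le> r" "yo + yj \<le> bj" using E(3,4) F tk bud thr(1) by linarith+
    then show False using n tk bud by linarith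
  qed
qed

text \<open>\<open>latin_arith_step\<close>, for all orders of the colours and both sides, shows
  that no cover holds the reference class together with another class. So each other class fits into
  its own cover, and the sum over both sides is at most \<open>2 * (r + g + g)\<close>.\<close>

lemma latin_arith:
  fixes n r g :: nat
  assumes thr: "r \<le> g"
    and n: "r + g + g < n" "n \<le> xo + x1 + x2 + x3" "n \<le> yo + y1 + y2 + y3"
    and bud: "a1 + b1 \<le> r" "a2 + b2 \<le> g" "a3 + b3 \<le> g"
    and o: "xo \<le> a1 + a2 + a3" "yo \<le> b1 + b2 + b3"
    and x: "x1 \<le> a1 \<or> yo + y1 \<le> b1" "x2 \<le> a2 \<or> yo + y2 \<le> b2" "x3 \<le> a3 \<or> yo + y3 \<le> b3"
    and y: "xo + x1 \<le> a1 \<or> y1 \<le> b1" "xo + x2 \<le> a2 \<or> y2 \<le> b2" "xo + x3 \<le> a3 \<or> y3 \<le> b3"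
    and xy: "x1 \<le> g \<or> y2 \<le> g" "x1 \<le> g \<or> y3 \<le> g" "x2 \<le> g \<or> y1 \<le> g"
      "x2 \<le> r \<or> y3 \<le> r" "x3 \<le> g \<or> y1 \<le> g" "x3 \<le> r \<or> y2 \<le> r"
  shows False
proof -
  have le: "a1 \<le> r" "b1 \<le> r" "a2 \<le> g" "b2 \<le> g" "a3 \<le> g" "b3 \<le> g" using bud by auto
  have Y: False if i: "yo + y1 \<le> b1 \<or> yo + y2 \<le> b2 \<or> yo + y3 \<le> b3"
  proof -
    note step = latin_arith_step[OF thr _ n(1)]
    from i consider "yo + y1 \<le> b1" | "yo + y2 \<le> b2" | "yo + y3 \<le> b3" by blast
    then show False
    proof cases
      case 1
      \<comment> \<open>The other two classes exceed the sum of their thresholds, so one exceeds the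
        threshold of the other's colour; it plays \<open>j\<close>.\<close>
      then have "g < y2 \<or> g < y3" using n le by linarith
      then show False
      proof
        assume "g < y2"
        show False
          by (rule step[of r g g xo x1 x2 x3 yo y1 y2 y3 b1 a2 b2 a3 b3]) ((fact | (subst disj_commute, fact) | (simp; fail) | use n le in linarith)+)
      next
        assume "g < y3"
        show False
          by (rule step[of r g g xo x1 x3 x2 yo y1 y3 y2 b1 a3 b3 a2 b2]) ((fact | (subst disj_commute, fact) | (simp; fail) | use n le in linarith)+)
      qed
    next
      case 2
      then have "g < y1 \<or> r < y3" using n le by linarith
      then show False
      proof
        assume "g < y1"
        show False
          by (rule step[of g r g xo x2 x1 x3 yo y2 y1 y3 b2 a1 b1 a3 b3]) ((fact | (subst disj_commute, fact) | (simp; fail) | use n le in linarith)+)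
      next
        assume "r < y3"
        show False
          by (rule step[of g g r xo x2 x3 x1 yo y2 y3 y1 b2 a3 b3 a1 b1]) ((fact | (subst disj_commute, fact) | (simp; fail) | use n le in linarith)+)
      qed
    next
      case 3
      then have "g < y1 \<or> r < y2" using n le by linarith
      then show False
      proof
        assume "g < y1"
        show False
          by (rule step[of g r g xo x3 x1 x2 yo y3 y1 y2 b3 a1 b1 a2 b2]) ((fact | (subst disj_commute, fact) | (simp; fail) | use n le in linarith)+)
      next
        assume "r < y2"
        show False
          by (rule step[of g g r xo x3 x2 x1 yo y3 y2 y1 b3 a2 b2 a1 b1]) ((fact | (subst disj_commute, fact) | (simp; fail) | use n le in linarith)+)
      qed
    qed
  qed
  have X: False if i: "xo + x1 \<le> a1 \<or> xo + x2 \<le> a2 \<or> xo + x3 \<le> a3"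
  proof -
    note step = latin_arith_step[OF thr _ n(1)]
    from i consider "xo + x1 \<le> a1" | "xo + x2 \<le> a2" | "xo + x3 \<le> a3" by blast
    then show False
    proof cases
      case 1
      then have "g < x2 \<or> g < x3" using n le by linarith
      then show False
      proof
        assume "g < x2"
        show False
          by (rule step[of r g g yo y1 y2 y3 xo x1 x2 x3 a1 b2 a2 b3 a3]) ((fact | (subst disj_commute, fact) | (simp; fail) | use n le in linarith)+)
      next
        assume "g < x3"
        show False
          by (rule step[of r g g yo y1 y3 y2 xo x1 x3 x2 a1 b3 a3 b2 a2]) ((fact | (subst disj_commute, fact) | (simp; fail) | use n le in linarith)+)
      qed
    next
      case 2
      then have "g < x1 \<or> r < x3" using n le by linarith
      then show False
      proof
        assume "g < x1"
        show False
          by (rule step[of g r g yo y2 y1 y3 xo x2 x1 x3 a2 b1 a1 b3 a3]) ((fact | (subst disj_commute, fact) | (simp; fail) | use n le in linarith)+)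
      next
        assume "r < x3"
        show False
          by (rule step[of g g r yo y2 y3 y1 xo x2 x3 x1 a2 b3 a3 b1 a1]) ((fact | (subst disj_commute, fact) | (simp; fail) | use n le in linarith)+)
      qed
    next
      case 3
      then have "g < x1 \<or> r < x2" using n le by linarith
      then show False
      proof
        assume "g < x1"
        show False
          by (rule step[of g r g yo y3 y1 y2 xo x3 x1 x2 a3 b1 a1 b2 a2]) ((fact | (subst disj_commute, fact) | (simp; fail) | use n le in linarith)+)
      next
        assume "r < x2"
        show False
          by (rule step[of g g r yo y3 y2 y1 xo x3 x2 x1 a3 b2 a2 b1 a1]) ((fact | (subst disj_commute, fact) | (simp; fail) | use n le in linarith)+)
      qed
    qed
  qed
  have "x1 \<le> a1" "x2 \<le> a2" "x3 \<le> a3" "y1 \<le> b1" "y2 \<le> b2" "y3 \<le> b3" using x y X Y by blast+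
  then show False using n bud o by linarith
qed

lemma forall_colour: "(\<forall>c. P c) \<longleftrightarrow> P Red \<and> P Blue \<and> P Green"
  by (metis colour.exhaust)

context cover_labelling
begin

section \<open>Label types relative to three pairwise antipodal vertices\<close>

definition antipodal :: "'v \<Rightarrow> 'v \<Rightarrow> bool" where
  "antipodal u v \<longleftrightarrow> (\<forall>c. lab c u \<noteq> lab c v)"

lemma antipodal_iff:
  "antipodal u v \<longleftrightarrow> lab Red u \<noteq> lab Red v \<and> lab Blue u \<noteq> lab Blue v \<and> lab Green u \<noteq> lab Green v"
  by (simp add: antipodal_def forall_colour)

definition "type_of a b c S = {v \<in> S. lab Red v = lab Red a \<and> lab Blue v = lab Blue b \<and> lab Green v = lab Green c}"

lemma agree:
  assumes "x \<in> X" "y \<in> Y"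
  shows "lab Red x = lab Red y \<or> lab Blue x = lab Blue y \<or> lab Green x = lab Green y"
proof -
  obtain c where "lab c x = lab c y" using dom[OF assms] by blast
  then show ?thesis by (cases c) auto
qed

lemma covered_pair:
  assumes "S \<subseteq> X" "T \<subseteq> Y" "\<forall>v\<in>S \<union> T. lab c v = i" "\<forall>x\<in>S. \<forall>y\<in>T. \<forall>d. d \<noteq> c \<longrightarrow> lab d x \<noteq> lab d y"
  shows "S \<subseteq> A c i \<or> T \<subseteq> B c i"
proof (rule ccontr)
  assume "\<not> ?thesis"
  then obtain x y where xy: "x \<in> S" "x \<notin> A c i" "y \<in> T" "y \<notin> B c i" by blast
  then obtain d where d: "lab d x = lab d y" "cov d x \<or> cov d y" using dom assms(1,2) by blast
  then have "d = c" using assms(4) xy by blast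
  with d xy assms(1-3) show False by (auto simp: covered_def)
qed

text \<open>Each label of \<open>x\<close> matches at most one of three pairwise antipodal vertices,
  and all three need a match, so the labels are distributed as a permutation.\<close>

lemma permutation_type:
  assumes w: "w0 \<in> Y" "w1 \<in> Y" "w2 \<in> Y" "antipodal w0 w1" "antipodal w0 w2" "antipodal w1 w2" and x: "x \<in> X"
  obtains "x \<in> type_of w0 w1 w2 X" | "x \<in> type_of w0 w2 w1 X" | "x \<in> type_of w1 w0 w2 X"
    | "x \<in> type_of w1 w2 w0 X" | "x \<in> type_of w2 w0 w1 X" | "x \<in> type_of w2 w1 w0 X"
proof -
  have "x \<in> type_of w0 w1 w2 X \<or> x \<in> type_of w0 w2 w1 X \<or> x \<in> type_of w1 w0 w2 X
    \<or> x \<in> type_of w1 w2 w0 X \<or> x \<in> type_of w2 w0 w1 X \<or> x \<in> type_of w2 w1 w0 X"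
    using agree[OF x w(1)] agree[OF x w(2)] agree[OF x w(3)] w(4-6) x
    unfolding type_of_def antipodal_iff by (elim disjE) simp_all
  then show thesis using that by blast
qed

text \<open>By \<open>permutation_type\<close> an \<open>x\<close> meets a constant type in a single
  colour, so \<open>covered_pair\<close> applies: a type too large for its cover pushes the vertices
  of \<open>X\<close> meeting it into theirs. Hence no type exceeds \<open>t Green\<close> and one
  is at most \<open>t Red\<close>, too few for \<open>Y\<close>.\<close>

lemma three_types:
  assumes w: "w0 \<in> Y" "w1 \<in> Y" "w2 \<in> Y" "antipodal w0 w1" "antipodal w0 w2" "antipodal w1 w2"
    and Y: "Y = type_of w0 w0 w0 Y \<union> type_of w1 w1 w1 Y \<union> type_of w2 w2 w2 Y"
  shows False
proof -
  define Xc where "Xc c w = {x \<in> X. lab c x = lab c w}" for c w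
  have pair: "Xc c w \<subseteq> A c (lab c w) \<or> type_of w w w Y \<subseteq> B c (lab c w)" if "w \<in> {w0, w1, w2}" for c w
  proof (rule covered_pair)
    show "\<forall>x\<in>Xc c w. \<forall>y\<in>type_of w w w Y. \<forall>d. d \<noteq> c \<longrightarrow> lab d x \<noteq> lab d y"
    proof (intro ballI)
      fix x y assume x: "x \<in> Xc c w" and y: "y \<in> type_of w w w Y"
      have "x \<in> X" using x by (simp add: Xc_def)
      from w this have "\<forall>d. d \<noteq> c \<longrightarrow> lab d x \<noteq> lab d w"
        by (rule permutation_type)
          (use that x w(4-6) in \<open>cases c; auto simp: Xc_def type_of_def antipodal_iff forall_colour\<close>)+
      then show "\<forall>d. d \<noteq> c \<longrightarrow> lab d x \<noteq> lab d y" using y by (auto simp: type_of_def forall_colour)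
    qed
    show "\<forall>v\<in>Xc c w \<union> type_of w w w Y. lab c v = lab c w"
      by (cases c) (auto simp: Xc_def type_of_def)
  qed (auto simp: Xc_def type_of_def)
  have large: "card (type_of w w w Y) \<le> t Green" if w: "w \<in> {w0, w1, w2}" for w
  proof (rule ccontr)
    assume *: "\<not> ?thesis"
    have "\<not> type_of w w w Y \<subseteq> B c (lab c w)" for c
    proof
      assume "type_of w w w Y \<subseteq> B c (lab c w)"
      then have "card (type_of w w w Y) \<le> card (B c (lab c w))" by (intro card_mono) auto
      also have "\<dots> \<le> t c" by (rule card_B)
      finally show False using * thr_le thr_eq by (cases c) auto
    qed
    then have sub: "Xc c w \<subseteq> A c (lab c w)" for c using pair[OF w] by blast
    obtain x where x: "x \<in> X" "x \<notin> A Red (lab Red w)" "x \<notin> A Blue (lab Blue w)" "x \<notin> A Green (lab Green w)"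
      using ex_uncovered3[of Red Blue Green "lab Red w" "lab Blue w" "lab Green w"] by auto
    have "w \<in> Y" using w assms(1-3) by auto
    from agree[OF x(1) this] show False using x sub by (auto simp: Xc_def)
  qed
  have "\<exists>w\<in>{w0, w1, w2}. card (type_of w w w Y) \<le> t Red"
  proof (rule ccontr)
    assume *: "\<not> ?thesis"
    have "Xc Red w \<subseteq> A Red (lab Red w)" if w: "w \<in> {w0, w1, w2}" for w
    proof -
      have "\<not> type_of w w w Y \<subseteq> B Red (lab Red w)"
        using * w card_mono[OF finite_B, of "type_of w w w Y" Red "lab Red w"] card_B[of Red "lab Red w"]
        by (meson order.trans)
      then show ?thesis using pair[OF w] by blast
    qed
    moreover have "x \<in> Xc Red w0 \<union> Xc Red w1 \<union> Xc Red w2" if "x \<in> X" for x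
      using w that by (rule permutation_type) (auto simp: type_of_def Xc_def)
    ultimately have "X \<subseteq> A Red (lab Red w0) \<union> A Red (lab Red w1) \<union> A Red (lab Red w2) \<union> {} \<union> {} \<union> {}"
      by blast
    from card_le6[OF this] show False
      using card_A[of Red "lab Red w0"] card_A[of Red "lab Red w1"] card_A[of Red "lab Red w2"] thr_le thr_eq thr_sum by simp
  qed
  then have "card (type_of w0 w0 w0 Y) + card (type_of w1 w1 w1 Y) + card (type_of w2 w2 w2 Y) \<le> t Red + t Green + t Green"
    using large[of w0] large[of w1] large[of w2] by auto
  moreover have "card Y \<le> card (type_of w0 w0 w0 Y) + card (type_of w1 w1 w1 Y) + card (type_of w2 w2 w2 Y)"
    by (subst Y) (intro order.trans[OF card_Un_le] add_mono order.refl)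
  ultimately show False using thr_sum thr_eq card_eq by simp
qed

text \<open>Reading types as permutations of \<open>w0, w1, w2\<close>, the vertex \<open>z\<close> is the identity, so that \<open>X\<close>
  consists of the identity and the three transpositions.\<close>

lemma latin_other:
  assumes w: "w0 \<in> Y" "w1 \<in> Y" "w2 \<in> Y" "antipodal w0 w1" "antipodal w0 w2" "antipodal w1 w2"
    and o: "z \<in> type_of w0 w1 w2 Y"
  shows False
proof -
  interpret D: cover_labelling Y X lab cov t by (rule dual)
  note [simp] = type_of_def
  have anti: "lab c w0 \<noteq> lab c w1" "lab c w0 \<noteq> lab c w2" "lab c w1 \<noteq> lab c w2" for c
    using w(4-6) by (auto simp: antipodal_def)
  note anti' = anti anti[symmetric]
  \<comment> \<open>Agreement with \<open>z\<close> rules out the two cyclic permutations.\<close>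
  have X: "x \<in> type_of w0 w1 w2 X \<union> type_of w0 w2 w1 X \<union> type_of w2 w1 w0 X \<union> type_of w1 w0 w2 X"
    if x: "x \<in> X" for x
    using w x by (rule permutation_type) (use agree[OF x, of z] o in \<open>simp_all add: anti'\<close>)
  obtain x1 where x1: "x1 \<in> type_of w0 w2 w1 X"
    using third_label_X[of Blue "lab Blue w0" "lab Blue w1"] X by fastforce
  obtain x2 where x2: "x2 \<in> type_of w2 w1 w0 X"
    using third_label_X[of Red "lab Red w0" "lab Red w1"] X by fastforce
  obtain x3 where x3: "x3 \<in> type_of w1 w0 w2 X"
    using third_label_X[of Red "lab Red w0" "lab Red w2"] X by fastforce
  show False
  proof (cases "\<exists>x. x \<in> type_of w0 w1 w2 X")
    case False
    show False
    \<comment> \<open>The three transpositions are pairwise antipodal, so \<open>X\<close> itself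
      now consists of three constant types.\<close>
    proof (rule D.three_types[of x1 x2 x3])
      show "X = type_of x1 x1 x1 X \<union> type_of x2 x2 x2 X \<union> type_of x3 x3 x3 X"
        using X x1 x2 x3 False by auto
    qed (use x1 x2 x3 anti' in \<open>auto simp: antipodal_iff\<close>)
  next
    case True
    then obtain x0 where x0: "x0 \<in> type_of w0 w1 w2 X" by blast
    \<comment> \<open>Meeting the identity and all three transpositions leaves only the identity and
      the constant types.\<close>
    have Y: "y \<in> type_of w0 w1 w2 Y \<union> type_of w0 w0 w0 Y \<union> type_of w1 w1 w1 Y \<union> type_of w2 w2 w2 Y"
      if y: "y \<in> Y" for y
      using agree[OF _ y, of x0] agree[OF _ y, of x1] agree[OF _ y, of x2] agree[OF _ y, of x3] x0 x1 x2 x3 anti' y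
      by simp metis
    let ?Xo = "type_of w0 w1 w2 X" and ?X1 = "type_of w0 w2 w1 X" and ?X2 = "type_of w2 w1 w0 X"
      and ?X3 = "type_of w1 w0 w2 X"
    let ?Yo = "type_of w0 w1 w2 Y" and ?Y1 = "type_of w0 w0 w0 Y" and ?Y2 = "type_of w1 w1 w1 Y"
      and ?Y3 = "type_of w2 w2 w2 Y"
    let ?A1 = "A Red (lab Red w0)" and ?A2 = "A Blue (lab Blue w1)" and ?A3 = "A Green (lab Green w2)"
    let ?B1 = "B Red (lab Red w0)" and ?B2 = "B Blue (lab Blue w1)" and ?B3 = "B Green (lab Green w2)"
    have fin: "finite (type_of a b c X)" "finite (type_of a b c Y)" for a b c using finX finY by simp_all
    have cardU: "card (?Yo \<union> ?Y1) = card ?Yo + card ?Y1" "card (?Yo \<union> ?Y2) = card ?Yo + card ?Y2"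
      "card (?Yo \<union> ?Y3) = card ?Yo + card ?Y3" "card (?Xo \<union> ?X1) = card ?Xo + card ?X1"
      "card (?Xo \<union> ?X2) = card ?Xo + card ?X2" "card (?Xo \<union> ?X3) = card ?Xo + card ?X3"
      using fin by (intro card_Un_disjoint; auto simp: anti')+
    have pair: "card S \<le> card (A c i) \<or> card T \<le> card (B c i)"
      if "S \<subseteq> X" "T \<subseteq> Y" "\<forall>v\<in>S \<union> T. lab c v = i" "\<forall>x\<in>S. \<forall>y\<in>T. \<forall>d. d \<noteq> c \<longrightarrow> lab d x \<noteq> lab d y" for S T c i
      using covered_pair[OF that] card_mono finite_A finite_B by metis
    have pair': "card S \<le> t c \<or> card T \<le> t c"
      if "S \<subseteq> X" "T \<subseteq> Y" "\<forall>v\<in>S \<union> T. lab c v = i" "\<forall>x\<in>S. \<forall>y\<in>T. \<forall>d. d \<noteq> c \<longrightarrow> lab d x \<noteq> lab d y" for S T c i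
      using pair[OF that] card_A[of c i] card_B[of c i] by linarith
    show False
    proof (rule latin_arith[of "t Red" "t Green" "card X"])
      show "t Red \<le> t Green" "t Red + t Green + t Green < card X" using thr_le thr_sum thr_eq by auto
      have "X \<subseteq> ?Xo \<union> ?X1 \<union> ?X2 \<union> ?X3 \<union> {} \<union> {}" using X by blast
      from card_le6[OF this] show "card X \<le> card ?Xo + card ?X1 + card ?X2 + card ?X3" using fin by simp
      have "Y \<subseteq> ?Yo \<union> ?Y1 \<union> ?Y2 \<union> ?Y3 \<union> {} \<union> {}" using Y by blast
      from card_le6[OF this] show "card X \<le> card ?Yo + card ?Y1 + card ?Y2 + card ?Y3" using fin card_eq by simp
      show "card ?A1 + card ?B1 \<le> t Red" "card ?A2 + card ?B2 \<le> t Green" "card ?A3 + card ?B3 \<le> t Green"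
        using budget[of Red] budget[of Blue] budget[of Green] thr_eq by auto
      have "?Xo \<subseteq> ?A1 \<union> ?A2 \<union> ?A3 \<union> {} \<union> {} \<union> {}"
      proof
        fix x assume x: "x \<in> ?Xo"
        then obtain c where "cov c x" using D.ex_cov[of x] by auto
        then show "x \<in> ?A1 \<union> ?A2 \<union> ?A3 \<union> {} \<union> {} \<union> {}" using x by (cases c) (auto simp: covered_def)
      qed
      from card_le6[OF this] show "card ?Xo \<le> card ?A1 + card ?A2 + card ?A3" by simp
      have "?Yo \<subseteq> ?B1 \<union> ?B2 \<union> ?B3 \<union> {} \<union> {} \<union> {}"
      proof
        fix y assume y: "y \<in> ?Yo"
        then obtain c where "cov c y" using ex_cov[of y] by auto
        then show "y \<in> ?B1 \<union> ?B2 \<union> ?B3 \<union> {} \<union> {} \<union> {}" using y by (cases c) (auto simp: covered_def)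
      qed
      from card_le6[OF this] show "card ?Yo \<le> card ?B1 + card ?B2 + card ?B3" by simp
      show "card ?X1 \<le> card ?A1 \<or> card ?Yo + card ?Y1 \<le> card ?B1"
        unfolding cardU[symmetric] by (rule pair) (auto simp: forall_colour anti')
      show "card ?X2 \<le> card ?A2 \<or> card ?Yo + card ?Y2 \<le> card ?B2"
        unfolding cardU[symmetric] by (rule pair) (auto simp: forall_colour anti')
      show "card ?X3 \<le> card ?A3 \<or> card ?Yo + card ?Y3 \<le> card ?B3"
        unfolding cardU[symmetric] by (rule pair) (auto simp: forall_colour anti')
      show "card ?Xo + card ?X1 \<le> card ?A1 \<or> card ?Y1 \<le> card ?B1"
        unfolding cardU[symmetric] by (rule pair) (auto simp: forall_colour anti')
      show "card ?Xo + card ?X2 \<le> card ?A2 \<or> card ?Y2 \<le> card ?B2"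
        unfolding cardU[symmetric] by (rule pair) (auto simp: forall_colour anti')
      show "card ?Xo + card ?X3 \<le> card ?A3 \<or> card ?Y3 \<le> card ?B3"
        unfolding cardU[symmetric] by (rule pair) (auto simp: forall_colour anti')
      show "card ?X1 \<le> t Green \<or> card ?Y2 \<le> t Green"
        by (rule pair'[of _ _ _ "lab Green w1"]) (auto simp: forall_colour anti')
      show "card ?X1 \<le> t Green \<or> card ?Y3 \<le> t Green" unfolding thr_eq[symmetric]
        by (rule pair'[of _ _ _ "lab Blue w2"]) (auto simp: forall_colour anti')
      show "card ?X2 \<le> t Green \<or> card ?Y1 \<le> t Green"
        by (rule pair'[of _ _ _ "lab Green w0"]) (auto simp: forall_colour anti')
      show "card ?X2 \<le> t Red \<or> card ?Y3 \<le> t Red"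
        by (rule pair'[of _ _ _ "lab Red w2"]) (auto simp: forall_colour anti')
      show "card ?X3 \<le> t Green \<or> card ?Y1 \<le> t Green" unfolding thr_eq[symmetric]
        by (rule pair'[of _ _ _ "lab Blue w0"]) (auto simp: forall_colour anti')
      show "card ?X3 \<le> t Red \<or> card ?Y2 \<le> t Red"
        by (rule pair'[of _ _ _ "lab Red w1"]) (auto simp: forall_colour anti')
    qed
  qed
qed

text \<open>A vertex \<open>z\<close> of \<open>Y\<close> of no constant type is forced by the third
  labels on \<open>X\<close> to be a permutation too, and \<open>latin_other\<close> excludes each
  of the six.\<close>

lemma latin:
  assumes w: "w0 \<in> Y" "w1 \<in> Y" "w2 \<in> Y" "antipodal w0 w1" "antipodal w0 w2" "antipodal w1 w2"
  shows False
proof (cases "Y = type_of w0 w0 w0 Y \<union> type_of w1 w1 w1 Y \<union> type_of w2 w2 w2 Y")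
  case True
  with w show False by (rule three_types)
next
  case False
  then obtain z where z: "z \<in> Y" "z \<notin> type_of w0 w0 w0 Y" "z \<notin> type_of w1 w1 w1 Y" "z \<notin> type_of w2 w2 w2 Y"
    by (auto simp: type_of_def)
  have sym: "antipodal w1 w0" "antipodal w2 w0" "antipodal w2 w1" using w by (auto simp: antipodal_iff)
  \<comment> \<open>In each colour some \<open>x\<close> takes the label of \<open>a\<close>; its
    other two labels come from \<open>b\<close> and \<open>c\<close> in some order, and
    \<open>z\<close> must meet it.\<close>
  have clauses: "lab Red z = lab Red a \<or> lab Blue z = lab Blue b \<or> lab Blue z = lab Blue c \<or> lab Green z = lab Green b \<or> lab Green z = lab Green c"
    "lab Blue z = lab Blue a \<or> lab Red z = lab Red b \<or> lab Red z = lab Red c \<or> lab Green z = lab Green b \<or> lab Green z = lab Green c"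
    "lab Green z = lab Green a \<or> lab Red z = lab Red b \<or> lab Red z = lab Red c \<or> lab Blue z = lab Blue b \<or> lab Blue z = lab Blue c"
    if abc: "a \<in> Y" "b \<in> Y" "c \<in> Y" "antipodal a b" "antipodal a c" "antipodal b c" for a b c
  proof -
    obtain x where x: "x \<in> X" "lab Red x \<noteq> lab Red b" "lab Red x \<noteq> lab Red c" using third_label_X by blast
    show "lab Red z = lab Red a \<or> lab Blue z = lab Blue b \<or> lab Blue z = lab Blue c \<or> lab Green z = lab Green b \<or> lab Green z = lab Green c"
      using abc x(1) by (rule permutation_type) (use agree[OF x(1) z(1)] x in \<open>auto simp: type_of_def\<close>)
  next
    obtain x where x: "x \<in> X" "lab Blue x \<noteq> lab Blue b" "lab Blue x \<noteq> lab Blue c" using third_label_X by blast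
    show "lab Blue z = lab Blue a \<or> lab Red z = lab Red b \<or> lab Red z = lab Red c \<or> lab Green z = lab Green b \<or> lab Green z = lab Green c"
      using abc x(1) by (rule permutation_type) (use agree[OF x(1) z(1)] x in \<open>auto simp: type_of_def\<close>)
  next
    obtain x where x: "x \<in> X" "lab Green x \<noteq> lab Green b" "lab Green x \<noteq> lab Green c" using third_label_X by blast
    show "lab Green z = lab Green a \<or> lab Red z = lab Red b \<or> lab Red z = lab Red c \<or> lab Blue z = lab Blue b \<or> lab Blue z = lab Blue c"
      using abc x(1) by (rule permutation_type) (use agree[OF x(1) z(1)] x in \<open>auto simp: type_of_def\<close>)
  qed
  have "z \<in> type_of w0 w1 w2 Y \<or> z \<in> type_of w0 w2 w1 Y \<or> z \<in> type_of w1 w0 w2 Y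
    \<or> z \<in> type_of w1 w2 w0 Y \<or> z \<in> type_of w2 w0 w1 Y \<or> z \<in> type_of w2 w1 w0 Y"
    using clauses[OF w(1,2,3,4,5,6)] clauses[OF w(2,1,3) sym(1) w(6,5)] clauses[OF w(3,1,2) sym(2,3) w(4)]
      z w(4-6)
    unfolding type_of_def antipodal_iff mem_Collect_eq by argo
  then show False
    using latin_other[OF w] latin_other[OF w(1,3,2,5,4) sym(3)] latin_other[OF w(2,1,3) sym(1) w(6,5)]
      latin_other[OF w(2,3,1,6) sym(1,2)] latin_other[OF w(3,1,2) sym(2,3) w(4)] latin_other[OF w(3,2,1) sym(3,2,1)]
    by blast
qed

end

section \<open>Classification of the label triples\<close>

context cover_labelling
begin

text \<open>By \<open>latin\<close> no vertex of \<open>X\<close> is antipodal to both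
  \<open>x0\<close> and \<open>x1\<close>. Vertices \<open>y2\<close>, \<open>y3\<close> with third
  labels in \<open>Blue\<close> and \<open>Green\<close> meet \<open>x0\<close> and
  \<open>x1\<close> crosswise, in four patterns: one makes \<open>y1\<close>, \<open>y2\<close>,
  \<open>y3\<close> pairwise antipodal, the others confine all vertices to two components of
  different colours.\<close>

lemma antipodal_pair_aux:
  assumes x: "x0 \<in> X" "x1 \<in> X" "antipodal x0 x1"
    and y1: "y1 \<in> Y" "lab Red y1 \<noteq> lab Red x0" "lab Red y1 \<noteq> lab Red x1"
      "lab Blue y1 = lab Blue x0" "lab Green y1 = lab Green x1"
  shows False
proof -
  interpret D: cover_labelling Y X lab cov t by (rule dual)
  have X: "\<not> (antipodal v x0 \<and> antipodal v x1)" if "v \<in> X" for v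
    using D.latin[OF x(1,2) that x(3)] unfolding antipodal_iff by metis
  note x3 = x(3)[unfolded antipodal_iff]
  obtain y2 where y2: "y2 \<in> Y" "lab Blue y2 \<noteq> lab Blue x0" "lab Blue y2 \<noteq> lab Blue x1" using third_label_Y by blast
  obtain y3 where y3: "y3 \<in> Y" "lab Green y3 \<noteq> lab Green x0" "lab Green y3 \<noteq> lab Green x1" using third_label_Y by blast
  obtain xa where xa: "xa \<in> X" "lab Red xa \<noteq> lab Red x0" "lab Red xa \<noteq> lab Red x1" using third_label_X by blast
  obtain xb where xb: "xb \<in> X" "lab Blue xb \<noteq> lab Blue x0" "lab Blue xb \<noteq> lab Blue x1" using third_label_X by blast
  obtain xc where xc: "xc \<in> X" "lab Green xc \<noteq> lab Green x0" "lab Green xc \<noteq> lab Green x1" using third_label_X by blast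
  note XY = agree[OF _ y1(1)] agree[OF _ y2(1)] agree[OF _ y3(1)]
  note YX = agree[OF x(1)] agree[OF x(2)] agree[OF xa(1)] agree[OF xb(1)] agree[OF xc(1)]
  have Xall: "(lab Red v = lab Red y1 \<or> lab Blue v = lab Blue y1 \<or> lab Green v = lab Green y1) \<and>
      (lab Red v = lab Red y2 \<or> lab Blue v = lab Blue y2 \<or> lab Green v = lab Green y2) \<and>
      (lab Red v = lab Red y3 \<or> lab Blue v = lab Blue y3 \<or> lab Green v = lab Green y3) \<and>
      (lab Red v = lab Red x0 \<or> lab Blue v = lab Blue x0 \<or> lab Green v = lab Green x0 \<or>
       lab Red v = lab Red x1 \<or> lab Blue v = lab Blue x1 \<or> lab Green v = lab Green x1)" if "v \<in> X" for v
    using XY[OF that] X[OF that] unfolding antipodal_iff by argo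
  consider
      (00) "lab Red y2 = lab Red x0" "lab Green y2 = lab Green x1" "lab Red y3 = lab Red x0" "lab Blue y3 = lab Blue x1"
    | (01) "lab Red y2 = lab Red x0" "lab Green y2 = lab Green x1" "lab Red y3 = lab Red x1" "lab Blue y3 = lab Blue x0"
    | (10) "lab Red y2 = lab Red x1" "lab Green y2 = lab Green x0" "lab Red y3 = lab Red x0" "lab Blue y3 = lab Blue x1"
    | (11) "lab Red y2 = lab Red x1" "lab Green y2 = lab Green x0" "lab Red y3 = lab Red x1" "lab Blue y3 = lab Blue x0"
    using YX(1,2)[OF y2(1)] YX(1,2)[OF y3(1)] y2 y3 x3 by metis
  then show False
  proof cases
    case 00
    have types: "lab Red v = lab Red x0 \<and> lab Green v = lab Green x1 \<or>
        lab Blue v = lab Blue x1 \<and> lab Green v = lab Green x1 \<or>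
        lab Red v = lab Red x0 \<and> lab Blue v = lab Blue x0" if "v \<in> X" for v
      using Xall[OF that] 00 y1 y2 y3 x3 by (smt (verit))
    have Xv: "lab Red v = lab Red x0 \<or> lab Green v = lab Green x1" if "v \<in> X" for v
      using types[OF that] by blast
    have wit: "lab Green xa = lab Green x1" "lab Blue xa = lab Blue x1" "lab Red xb = lab Red x0" "lab Green xb = lab Green x1"
      "lab Red xc = lab Red x0" "lab Blue xc = lab Blue x0"
      using types[OF xa(1)] types[OF xb(1)] types[OF xc(1)] xa xb xc x3 by auto
    have "lab Red v = lab Red x0 \<or> lab Green v = lab Green x1" if "v \<in> Y" for v
      using YX[OF that] wit xa xb xc x3 by argo
    with Xv show False using two_colours[of Red Green "lab Red x0" "lab Green x1"] by blast
  next
    case 01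
    have types: "lab Red v = lab Red x1 \<and> lab Green v = lab Green x1 \<or>
        lab Blue v = lab Blue x0 \<and> lab Green v = lab Green x1 \<or>
        lab Red v = lab Red x0 \<and> lab Blue v = lab Blue x0" if "v \<in> X" for v
      using Xall[OF that] 01 y1 y2 y3 x3 by (smt (verit))
    have Xv: "lab Blue v = lab Blue x0 \<or> lab Green v = lab Green x1" if "v \<in> X" for v
      using types[OF that] by blast
    have wit: "lab Blue xa = lab Blue x0" "lab Green xa = lab Green x1" "lab Red xb = lab Red x1" "lab Green xb = lab Green x1"
      "lab Red xc = lab Red x0" "lab Blue xc = lab Blue x0"
      using types[OF xa(1)] types[OF xb(1)] types[OF xc(1)] xa xb xc x3 by auto
    have "lab Blue v = lab Blue x0 \<or> lab Green v = lab Green x1" if "v \<in> Y" for v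
      using YX[OF that] wit xa xb xc x3 by argo
    with Xv show False using two_colours[of Blue Green "lab Blue x0" "lab Green x1"] by blast
  next
    case 10
    have "antipodal y1 y2" "antipodal y1 y3" "antipodal y2 y3"
      using 10 y1 y2 y3 x3 by (auto simp: antipodal_iff)
    then show False using latin y1(1) y2(1) y3(1) by blast
  next
    case 11
    have types: "lab Red v = lab Red x1 \<and> lab Blue v = lab Blue x0 \<or>
        lab Red v = lab Red x1 \<and> lab Green v = lab Green x1 \<or>
        lab Blue v = lab Blue x0 \<and> lab Green v = lab Green x0" if "v \<in> X" for v
      using Xall[OF that] 11 y1 y2 y3 x3 by (smt (verit))
    have Xv: "lab Red v = lab Red x1 \<or> lab Blue v = lab Blue x0" if "v \<in> X" for v
      using types[OF that] by blast
    have wit: "lab Blue xa = lab Blue x0" "lab Green xa = lab Green x0" "lab Red xb = lab Red x1" "lab Green xb = lab Green x1"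
      "lab Red xc = lab Red x1" "lab Blue xc = lab Blue x0"
      using types[OF xa(1)] types[OF xb(1)] types[OF xc(1)] xa xb xc x3 by auto
    have "lab Red v = lab Red x1 \<or> lab Blue v = lab Blue x0" if "v \<in> Y" for v
      using YX[OF that] wit xa xb xc x3 by argo
    with Xv show False using two_colours[of Red Blue "lab Red x1" "lab Blue x0"] by blast
  qed
qed

text \<open>A \<open>y\<close> with a third red label meets one of \<open>x0\<close>,
  \<open>x1\<close> in \<open>Blue\<close> and the other in \<open>Green\<close>, which is the
  previous situation up to exchanging them.\<close>

lemma antipodal_pair:
  assumes x: "x0 \<in> X" "x1 \<in> X" "antipodal x0 x1"
  shows False
proof -
  obtain y where y: "y \<in> Y" "lab Red y \<noteq> lab Red x0" "lab Red y \<noteq> lab Red x1" using third_label_Y by blast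
  have sym: "antipodal x1 x0" using x(3) by (auto simp: antipodal_iff)
  show False
    using agree[OF x(1) y(1)] agree[OF x(2) y(1)] y x(3) antipodal_pair_aux[OF x y] antipodal_pair_aux[OF x(2,1) sym y(1,3,2)]
    by (auto simp: antipodal_iff)
qed

text \<open>Any two vertices of \<open>X\<close> now agree in some colour. Two of them differ in
  \<open>Red\<close> only, and whatever meets both shares their label in \<open>Blue\<close> or
  \<open>Green\<close>, against \<open>two_colours\<close>.\<close>

lemma no_cover_labelling: False
proof -
  have XX: "lab Red x = lab Red y \<or> lab Blue x = lab Blue y \<or> lab Green x = lab Green y" if "x \<in> X" "y \<in> X" for x y
    using antipodal_pair[OF that] by (auto simp: antipodal_iff)
  obtain x1 where x1: "x1 \<in> X" using third_label_X by blast
  obtain x2 where x2: "x2 \<in> X" "lab Red x2 \<noteq> lab Red x1" using third_label_X by blast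
  obtain x3 where x3: "x3 \<in> X" "lab Red x3 \<noteq> lab Red x1" "lab Red x3 \<noteq> lab Red x2" using third_label_X by blast
  obtain x4 where x4: "x4 \<in> X" "lab Blue x4 \<noteq> lab Blue x1" "lab Blue x4 \<noteq> lab Blue x2" using third_label_X by blast
  obtain x5 where x5: "x5 \<in> X" "lab Green x5 \<noteq> lab Green x1" "lab Green x5 \<noteq> lab Green x2" using third_label_X by blast
  \<comment> \<open>Otherwise each pair of \<open>x1\<close>, \<open>x2\<close>, \<open>x3\<close>
    agrees in exactly one of \<open>Blue\<close> and \<open>Green\<close>. Two pairs share that
    colour, hence all do; then \<open>x4\<close> or \<open>x5\<close>, missing the common label,
    cannot meet all three with its two other labels.\<close>
  have "\<exists>u\<in>X. \<exists>v\<in>X. lab Red u \<noteq> lab Red v \<and> lab Blue u = lab Blue v \<and> lab Green u = lab Green v"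
  proof (rule ccontr)
    assume *: "\<not> ?thesis"
    have **: "lab Red u = lab Red v \<or> lab Blue u \<noteq> lab Blue v \<or> lab Green u \<noteq> lab Green v" if "u \<in> X" "v \<in> X" for u v
      using * that by blast
    show False
      using **[OF x1 x2(1)] **[OF x1 x3(1)] **[OF x2(1) x3(1)] XX[OF x1 x2(1)] XX[OF x1 x3(1)] XX[OF x2(1) x3(1)]
        XX[OF x4(1) x1] XX[OF x4(1) x2(1)] XX[OF x4(1) x3(1)] XX[OF x5(1) x1] XX[OF x5(1) x2(1)] XX[OF x5(1) x3(1)]
        x2 x3 x4 x5 by (smt (verit))
  qed
  then obtain u v where uv: "u \<in> X" "v \<in> X" "lab Red u \<noteq> lab Red v" "lab Blue u = lab Blue v" "lab Green u = lab Green v"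
    by blast
  have "lab Blue x = lab Blue u \<or> lab Green x = lab Green u" if "x \<in> X \<union> Y" for x
    using that agree[OF uv(1)] agree[OF uv(2)] XX[OF uv(1)] XX[OF uv(2)] uv by (metis Un_iff)
  then show False using two_colours[of Blue Green] by blast
qed

end

section \<open>Koenig's theorem\<close>

definition vertex_cover :: "'a set set \<Rightarrow> 'a set \<Rightarrow> bool" where
  "vertex_cover E C \<longleftrightarrow> finite C \<and> (\<forall>e\<in>E. e \<inter> C \<noteq> {})"

text \<open>Uncrossing: intersecting \<open>C1\<close> and \<open>C2\<close> on one side of the bipartition while uniting them on the
  other gives two sets of the same total size, of which one covers \<open>E\<close> and the other does so once \<open>x\<close>
  is added.\<close>

lemma critical_edges_disjoint:
  assumes bip: "\<forall>e\<in>E. \<exists>u v. e = {u, v} \<and> u \<in> S \<and> v \<notin> S"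
    and cover: "\<forall>C. vertex_cover E C \<longrightarrow> k \<le> card C"
    and e: "e = {x, y}" "e \<in> E" and f: "f = {x, z}" "f \<in> E" and xyz: "x \<in> S" "y \<notin> S" "z \<notin> S" "y \<noteq> z"
    and C1: "vertex_cover (E - {e}) C1" "card C1 < k" and C2: "vertex_cover (E - {f}) C2" "card C2 < k"
  shows False
proof -
  have fin: "finite C1" "finite C2" using C1 C2 by (auto simp: vertex_cover_def)
  have ef: "e \<noteq> f" using e f xyz by (auto simp: doubleton_eq_iff)
  have out1: "e \<inter> C1 = {}"
  proof (rule ccontr)
    assume "e \<inter> C1 \<noteq> {}"
    then have "vertex_cover E C1" using C1(1) by (auto simp: vertex_cover_def)
    then show False using cover C1(2) by auto
  qed
  have out2: "f \<inter> C2 = {}"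
  proof (rule ccontr)
    assume "f \<inter> C2 \<noteq> {}"
    then have "vertex_cover E C2" using C2(1) by (auto simp: vertex_cover_def)
    then show False using cover C2(2) by auto
  qed
  have cov1: "u \<in> C1 \<or> v \<in> C1" if "{u, v} \<in> E" "{u, v} \<noteq> e" for u v
  proof -
    have "{u, v} \<inter> C1 \<noteq> {}" using C1(1) that unfolding vertex_cover_def by blast
    then show ?thesis by auto
  qed
  have cov2: "u \<in> C2 \<or> v \<in> C2" if "{u, v} \<in> E" "{u, v} \<noteq> f" for u v
  proof -
    have "{u, v} \<inter> C2 \<noteq> {}" using C2(1) that unfolding vertex_cover_def by blast
    then show ?thesis by auto
  qed
  define T1 where "T1 = (C1 \<inter> C2 \<inter> S) \<union> ((C1 \<union> C2) - S)"
  define T2 where "T2 = ((C1 \<union> C2) \<inter> S) \<union> (C1 \<inter> C2 - S)"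
  have "vertex_cover E T1"
    unfolding vertex_cover_def
  proof (intro conjI ballI)
    fix g assume g: "g \<in> E"
    then obtain u v where uv: "g = {u, v}" "u \<in> S" "v \<notin> S" using bip by blast
    have "u \<in> C1 \<and> u \<in> C2" if v: "v \<notin> C1 \<union> C2"
    proof -
      \<comment> \<open>\<open>C1\<close> misses \<open>e\<close>, hence \<open>x\<close>, so it
        covers \<open>f\<close> through \<open>z\<close>; \<open>C2\<close> covers \<open>e\<close>
        through \<open>y\<close> likewise.\<close>
      have "z \<in> C1" using cov1[of x z] f ef e out1 by auto
      moreover have "y \<in> C2" using cov2[of x y] f ef e out2 by auto
      ultimately have "g \<noteq> e" "g \<noteq> f" using uv v e f xyz by (auto simp: doubleton_eq_iff)
      then show ?thesis using cov1[of u v] cov2[of u v] g uv v by auto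
    qed
    then show "g \<inter> T1 \<noteq> {}" using uv by (auto simp: T1_def)
  qed (use fin in \<open>auto simp: T1_def\<close>)
  then have k1: "k \<le> card T1" using cover by blast
  have "vertex_cover E (insert x T2)"
    unfolding vertex_cover_def
  proof (intro conjI ballI)
    fix g assume g: "g \<in> E"
    then obtain u v where uv: "g = {u, v}" "u \<in> S" "v \<notin> S" using bip by blast
    show "g \<inter> insert x T2 \<noteq> {}"
    proof (cases "u = x")
      case False
      then have "g \<noteq> e" "g \<noteq> f" using uv e f xyz by (auto simp: doubleton_eq_iff)
      then show ?thesis using cov1[of u v] cov2[of u v] g uv by (auto simp: T2_def)
    qed (use uv in auto)
  qed (use fin in \<open>auto simp: T2_def\<close>)
  then have "k \<le> card (insert x T2)" using cover by blast
  also have "\<dots> \<le> Suc (card T2)" using fin by (simp add: T2_def card_insert_if)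
  finally have k2: "k \<le> Suc (card T2)" .
  have "card T1 + card T2 = card (T1 \<union> T2) + card (T1 \<inter> T2)"
    using fin by (intro card_Un_Int) (auto simp: T1_def T2_def)
  also have "T1 \<union> T2 = C1 \<union> C2" by (auto simp: T1_def T2_def)
  also have "T1 \<inter> T2 = C1 \<inter> C2" by (auto simp: T1_def T2_def)
  also have "card (C1 \<union> C2) + card (C1 \<inter> C2) = card C1 + card C2"
    using fin by (intro card_Un_Int[symmetric]) auto
  \<comment> \<open>The sum is at most \<open>2 * k - 2\<close>, while \<open>k1\<close> and
    \<open>k2\<close> require at least \<open>2 * k - 1\<close>.\<close>
  finally show False using k1 k2 C1(2) C2(2) by linarith
qed

text \<open>Edges are deleted while covers still need \<open>k\<close> vertices. Once every edge is
  critical, no two meet, and one end of each edge forms a cover, so \<open>E\<close> itself has at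
  least \<open>k\<close> edges.\<close>

lemma konig:
  assumes "finite E" "\<forall>e\<in>E. \<exists>u v. e = {u, v} \<and> u \<in> S \<and> v \<notin> S"
    and "\<forall>C. vertex_cover E C \<longrightarrow> k \<le> card C"
  shows "\<exists>M\<subseteq>E. disjoint M \<and> k \<le> card M"
  using assms
proof (induction E rule: finite_psubset_induct)
  case (psubset E)
  show ?case
  proof (cases "\<exists>e\<in>E. \<forall>C. vertex_cover (E - {e}) C \<longrightarrow> k \<le> card C")
    case True
    then obtain e where e: "e \<in> E" "\<forall>C. vertex_cover (E - {e}) C \<longrightarrow> k \<le> card C" by blast
    have "\<exists>M\<subseteq>E - {e}. disjoint M \<and> k \<le> card M"
      using psubset.IH[of "E - {e}"] psubset.prems(1) e by blast
    then show ?thesis by blast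
  next
    case False
    then have crit: "\<exists>C. vertex_cover (E - {e}) C \<and> card C < k" if "e \<in> E" for e
      using that by (meson not_le)
    have "e \<inter> f = {}" if ef: "e \<in> E" "f \<in> E" "e \<noteq> f" for e f
    proof (rule ccontr)
      assume meet: "e \<inter> f \<noteq> {}"
      obtain x y where xy: "e = {x, y}" "x \<in> S" "y \<notin> S" using psubset.prems(1) ef(1) by blast
      obtain x' z where xz: "f = {x', z}" "x' \<in> S" "z \<notin> S" using psubset.prems(1) ef(2) by blast
      obtain C1 where C1: "vertex_cover (E - {e}) C1" "card C1 < k" using crit ef(1) by blast
      obtain C2 where C2: "vertex_cover (E - {f}) C2" "card C2 < k" using crit ef(2) by blast
      have bip': "\<forall>e\<in>E. \<exists>u v. e = {u, v} \<and> u \<in> - S \<and> v \<notin> - S"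
        using psubset.prems(1) by (metis ComplD ComplI insert_commute)
      from meet xy xz consider "x = x'" | "y = z" by auto
      then show False
      proof cases
        case 1
        then show False
          using critical_edges_disjoint[OF psubset.prems _ ef(1) _ ef(2) _ _ _ _ C1 C2, of x y z] xy xz ef(3) by auto
      next
        case 2
        then show False
          using critical_edges_disjoint[OF bip' psubset.prems(2) _ ef(1) _ ef(2) _ _ _ _ C1 C2, of y x x'] xy xz ef(3)
          by (auto simp: insert_commute)
      qed
    qed
    then have "disjoint E" by (auto simp: disjoint_def)
    moreover have "k \<le> card E"
    proof -
      have "e \<noteq> {}" if "e \<in> E" for e using psubset.prems(1) that by blast
      then have "vertex_cover E ((\<lambda>e. SOME v. v \<in> e) ` E)"
        using psubset.hyps by (auto simp: vertex_cover_def) (metis disjoint_iff imageI some_in_eq)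
      then show ?thesis using psubset.prems(2) card_image_le[OF psubset.hyps] by (meson order.trans)
    qed
    ultimately show ?thesis by blast
  qed
qed

section \<open>Matching numbers and components\<close>

lemma finite_matchings: "finite (edges G) \<Longrightarrow> finite {card M | M. matching G M}"
  by (rule finite_subset[of _ "card ` Pow (edges G)"]) (auto simp: matching_def)

lemma konig_matching_number:
  assumes fin: "finite (edges G)" and bip: "\<forall>e\<in>edges G. \<exists>u v. e = {u, v} \<and> u \<in> S \<and> v \<notin> S"
  shows "\<exists>C. vertex_cover (edges G) C \<and> card C \<le> matching_number G"
proof (rule ccontr)
  assume "\<not> ?thesis"
  then have "\<forall>C. vertex_cover (edges G) C \<longrightarrow> Suc (matching_number G) \<le> card C" by (meson not_less_eq_eq)
  from konig[OF fin bip this] obtain M where M: "matching G M" "Suc (matching_number G) \<le> card M"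
    by (auto simp: matching_def)
  then have "card M \<le> matching_number G"
    unfolding matching_number_def using finite_matchings[OF fin] by (intro Max_ge) auto
  with M(2) show False by simp
qed

lemma equiv_joined: "equiv (verts G) (joined_by_path G)"
proof -
  have "sym (adjacency G)" by (auto simp: sym_def adjacency_def insert_commute)
  then have "sym ((adjacency G)\<^sup>*)" by (rule sym_rtrancl)
  then show ?thesis
    by (auto simp: equiv_def refl_on_def sym_def trans_def joined_by_path_def)
qed

section \<open>The upper bound\<close>

lemma complete_bipartite_edge:
  "e \<in> edges (complete_bipartite n n) \<Longrightarrow> \<exists>i<n. \<exists>j<n. e = {Inl i, Inr j}"
  by (auto simp: complete_bipartite_def)

lemma finite_complete_bipartite: "finite (edges (complete_bipartite n n))"
proof -
  have "edges (complete_bipartite n n) \<subseteq> (\<lambda>(i, j). {Inl i, Inr j}) ` ({..<n} \<times> {..<n})"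
    by (auto simp: complete_bipartite_def)
  then show ?thesis by (rule finite_subset) auto
qed

text \<open>In a bad colouring, the components with their Koenig covers form a cover labelling of
  thresholds summing to \<open>k + 2 * m - 3\<close>, less than \<open>n\<close>.\<close>

lemma bipartite_ramsey_upper:
  assumes klm: "0 < k" "k \<le> l" "l \<le> m" and n: "k + 2 * m \<le> n + 2"
  shows "bipartite_ramsey_property k l m n"
proof (rule ccontr)
  assume "\<not> bipartite_ramsey_property k l m n"
  then obtain f where f: "\<not> connected_matching (complete_bipartite n n) f Red k H"
      "\<not> connected_matching (complete_bipartite n n) f Blue l H"
      "\<not> connected_matching (complete_bipartite n n) f Green m H" for H
    unfolding bipartite_ramsey_property_def by blast
  define G where "G = complete_bipartite n n"
  \<comment> \<open>Blue components even have matching number at most \<open>l - 1\<close>; relaxing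
    this to \<open>m - 1\<close> makes the two larger thresholds equal.\<close>
  define t where "t c = (case c of Red \<Rightarrow> k - 1 | Blue \<Rightarrow> m - 1 | Green \<Rightarrow> m - 1)" for c
  define cls where "cls c v = joined_by_path (colour_subgraph G f c) `` {v}" for c v
  define comp where "comp c K = induced_subgraph (colour_subgraph G f c) K" for c K
  define X Y :: "(nat + nat) set" where "X = Inl ` {..<n}" and "Y = Inr ` {..<n}"
  have verts: "verts (colour_subgraph G f c) = X \<union> Y" for c
    by (simp add: G_def X_def Y_def colour_subgraph_def complete_bipartite_def)
  have small: "matching_number (comp c (cls c v)) \<le> t c" if "v \<in> X \<union> Y" for c v
  proof -
    have "comp c (cls c v) \<in> components (colour_subgraph G f c)"
      using that unfolding components_def comp_def cls_def by (intro imageI quotientI) (simp add: verts)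
    then show ?thesis
      using f[of "comp c (cls c v)"] klm
      by (cases c) (auto simp: connected_matching_def G_def t_def)
  qed
  have edges: "edges (comp c K) \<subseteq> edges G" for c K
    by (auto simp: comp_def induced_subgraph_def colour_subgraph_def)
  have "\<exists>C. vertex_cover (edges (comp c K)) C \<and> card C \<le> matching_number (comp c K)" for c K
  proof (rule konig_matching_number)
    show "finite (edges (comp c K))"
      using edges finite_complete_bipartite unfolding G_def by (rule finite_subset)
    show "\<forall>e\<in>edges (comp c K). \<exists>u v. e = {u, v} \<and> u \<in> range Inl \<and> v \<notin> range Inl"
    proof
      fix e assume "e \<in> edges (comp c K)"
      then obtain i j where "e = {Inl i, Inr j}" using edges complete_bipartite_edge unfolding G_def by blast
      then show "\<exists>u v. e = {u, v} \<and> u \<in> range Inl \<and> v \<notin> range Inl" by blast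
    qed
  qed
  then obtain C where C: "vertex_cover (edges (comp c K)) (C c K)" "card (C c K) \<le> matching_number (comp c K)" for c K
    by metis
  define cov where "cov c v \<longleftrightarrow> v \<in> C c (cls c v)" for c v
  interpret cover_labelling X Y cls cov t
  proof
    show "finite X" "finite Y" "card X = card Y" by (auto simp: X_def Y_def card_image)
    show "t Red \<le> t Green" "t Blue = t Green" using klm by (auto simp: t_def)
    show "t Red + t Blue + t Green < card X" using klm n by (auto simp: t_def X_def card_image)
    show "\<exists>c. cls c x = cls c y \<and> (cov c x \<or> cov c y)" if xy: "x \<in> X" "y \<in> Y" for x y
    proof -
      let ?c = "f {x, y}"
      have e: "{x, y} \<in> edges (colour_subgraph G f ?c)"
        using xy by (auto simp: X_def Y_def G_def colour_subgraph_def complete_bipartite_def)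
      then have "(x, y) \<in> joined_by_path (colour_subgraph G f ?c)"
        using xy by (auto simp: joined_by_path_def adjacency_def verts)
      then have same: "cls ?c x = cls ?c y"
        unfolding cls_def using equiv_joined by (rule equiv_class_eq[rotated])
      have self: "v \<in> cls ?c v" if "v \<in> X \<union> Y" for v
        using that by (auto simp: cls_def joined_by_path_def verts)
      have "{x, y} \<in> edges (comp ?c (cls ?c x))"
        using e self[of x] self[of y] same xy by (auto simp: comp_def induced_subgraph_def)
      then have "x \<in> C ?c (cls ?c x) \<or> y \<in> C ?c (cls ?c x)"
        using C(1) by (fastforce simp: vertex_cover_def)
      then show ?thesis using same by (auto simp: cov_def)
    qed
    show "card (covered cls cov X c K) + card (covered cls cov Y c K) \<le> t c" for c K
    \<comment> \<open>\<open>K\<close> ranges over all sets. A covered vertex shows it to be a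
      component, so that its matching number is bounded.\<close>
    proof (cases "covered cls cov X c K \<union> covered cls cov Y c K = {}")
      case False
      then obtain v where v: "v \<in> X \<union> Y" "K = cls c v" by (auto simp: covered_def)
      have fin: "finite (C c K)" using C(1) by (simp add: vertex_cover_def)
      have sub: "covered cls cov X c K \<union> covered cls cov Y c K \<subseteq> C c K"
        by (auto simp: covered_def cov_def)
      have "card (covered cls cov X c K) + card (covered cls cov Y c K)
          = card (covered cls cov X c K \<union> covered cls cov Y c K)"
        using finite_subset[OF sub fin] by (intro card_Un_disjoint[symmetric]) (auto simp: covered_def X_def Y_def)
      also have "\<dots> \<le> card (C c K)" using sub fin by (rule card_mono[rotated])
      also have "\<dots> \<le> t c" using C(2) small[OF v(1)] v(2) order.trans by blast
      finally show ?thesis .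
    qed auto
  qed
  show False by (rule no_cover_labelling)
qed

section \<open>The lower bound\<close>

text \<open>Labels constant along edges are constant on components. Sending each edge of a matching
  to an end in \<open>C\<close> is injective, since the edges are disjoint, and stays within one
  label.\<close>

lemma matching_number_less:
  assumes K: "K \<in> components G" and fin: "finite (edges G)" and sub: "\<forall>e\<in>edges G. e \<subseteq> verts G"
    and lab: "\<forall>u v. {u, v} \<in> edges G \<longrightarrow> lab u = lab v"
    and cov: "\<forall>e\<in>edges G. e \<inter> C \<noteq> {}"
    and small: "\<forall>i. finite {v \<in> verts G. v \<in> C \<and> lab v = i} \<and> card {v \<in> verts G. v \<in> C \<and> lab v = i} < t"
  shows "matching_number K < t"
proof -
  obtain v where K_def: "K = induced_subgraph G (joined_by_path G `` {v})"
    using K by (auto simp: components_def quotient_def)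
  have lab_eq: "lab u = lab v" if "u \<in> joined_by_path G `` {v}" for u
  proof -
    have "(v, u) \<in> (adjacency G)\<^sup>*" using that by (auto simp: joined_by_path_def)
    then show ?thesis by (induction rule: rtrancl_induct) (use lab in \<open>auto simp: adjacency_def\<close>)
  qed
  have bound: "card M < t" if M: "matching K M" for M
  proof -
    define g where "g e = (SOME u. u \<in> e \<inter> C)" for e
    have ME: "e \<in> edges G \<and> e \<subseteq> joined_by_path G `` {v}" if "e \<in> M" for e
      using M that by (auto simp: matching_def K_def induced_subgraph_def)
    have g: "g e \<in> e \<inter> C" if "e \<in> M" for e
      unfolding g_def using ME[OF that] cov by (metis some_in_eq)
    have "inj_on g M"
    proof (rule inj_onI)
      fix e e' assume e: "e \<in> M" "e' \<in> M" "g e = g e'"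
      then have "e \<inter> e' \<noteq> {}" using g[of e] g[of e'] by auto
      then show "e = e'" using M e by (auto simp: matching_def disjoint_def)
    qed
    moreover have "g ` M \<subseteq> {u \<in> verts G. u \<in> C \<and> lab u = lab v}"
      using g ME lab_eq sub by blast
    ultimately have "card M \<le> card {u \<in> verts G. u \<in> C \<and> lab u = lab v}"
      using small by (metis card_inj_on_le)
    then show ?thesis using small by (meson order.strict_trans1)
  qed
  have "finite (edges K)" using fin by (auto simp: K_def induced_subgraph_def)
  moreover have "matching K {}" by (simp add: matching_def)
  ultimately have "Max {card M | M. matching K M} \<in> {card M | M. matching K M}"
    by (intro Max_in finite_matchings) auto
  then show ?thesis unfolding matching_number_def using bound by auto
qed

text \<open>With \<open>a = l - 1\<close>, \<open>b = m - 1\<close> and \<open>d = k - 1\<close> every component of the following colouring is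
  covered by a single block; the bound on \<open>m\<close> is what keeps the fourth row block from exceeding
  \<open>d\<close> rows.\<close>

definition row_block :: "nat \<Rightarrow> nat \<Rightarrow> nat \<Rightarrow> nat" where
  "row_block a d i = (if i < a then 1 else if i < 2 * a then 2 else if i < 2 * a + d then 3 else 4)"

definition col_block :: "nat \<Rightarrow> nat \<Rightarrow> nat" where
  "col_block b j = (if j < b then 1 else if j < 2 * b then 2 else 3)"

definition block_colour :: "nat \<Rightarrow> nat \<Rightarrow> colour" where
  "block_colour p q =
    (if q = 3 then (if p \<le> 2 then Red else Blue)
     else if p = q \<or> p = q + 2 then Green
     else if p \<le> 2 then Blue else Red)"

text \<open>Each colour joins a row block to exactly one column block, whose number serves as their
  common label.\<close>

definition block_label :: "nat \<Rightarrow> nat \<Rightarrow> nat \<Rightarrow> colour \<Rightarrow> nat + nat \<Rightarrow> nat" where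
  "block_label a b d c v = (case c of
      Red \<Rightarrow> (case v of Inl i \<Rightarrow> (case row_block a d i of p \<Rightarrow> if p = 3 then 2 else if p = 4 then 1 else 3)
                  | Inr j \<Rightarrow> col_block b j)
    | Blue \<Rightarrow> (case v of Inl i \<Rightarrow> (case row_block a d i of p \<Rightarrow> if p = 1 then 2 else if p = 2 then 1 else 3)
                  | Inr j \<Rightarrow> col_block b j)
    | Green \<Rightarrow> (case v of Inl i \<Rightarrow> (case row_block a d i of p \<Rightarrow> if p = 1 \<or> p = 3 then 1 else 2)
                  | Inr j \<Rightarrow> col_block b j))"

text \<open>Of each component it contains a side that is a single block, small enough for the
  colour.\<close>

definition block_cover :: "nat \<Rightarrow> nat \<Rightarrow> nat \<Rightarrow> colour \<Rightarrow> (nat + nat) set" where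
  "block_cover a b d c = (case c of
      Red \<Rightarrow> {Inl i | i. row_block a d i \<ge> 3} \<union> {Inr j | j. col_block b j = 3}
    | Blue \<Rightarrow> {Inl i | i. row_block a d i \<le> 2} \<union> {Inr j | j. col_block b j = 3}
    | Green \<Rightarrow> {Inr j | j. col_block b j \<le> 2})"

lemma bipartite_ramsey_lower:
  assumes klm: "0 < k" "k \<le> l" "l \<le> m" "2 * m \<le> 2 * l + k - 1" and n: "n + 2 < k + 2 * m"
  shows "\<not> bipartite_ramsey_property k l m n"
proof -
  define a b d where "a = l - 1" and "b = m - 1" and "d = k - 1"
  define G where "G = complete_bipartite n n"
  define f :: "(nat + nat) set \<Rightarrow> colour" where
    "f e = block_colour (row_block a d (THE i. Inl i \<in> e)) (col_block b (THE j. Inr j \<in> e))" for e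
  have f: "f {Inl i, Inr j} = block_colour (row_block a d i) (col_block b j)" for i j
    by (simp add: f_def)
  define t where "t c = (case c of Red \<Rightarrow> k | Blue \<Rightarrow> l | Green \<Rightarrow> m)" for c
  have small: "matching_number K < t c" if K: "K \<in> components (colour_subgraph G f c)" for c K
  proof (rule matching_number_less[OF K, where lab = "block_label a b d c" and C = "block_cover a b d c"])
    have sub: "edges (colour_subgraph G f c) \<subseteq> edges G" by (auto simp: colour_subgraph_def)
    then show "finite (edges (colour_subgraph G f c))"
      using finite_complete_bipartite unfolding G_def by (rule finite_subset)
    have edge: "\<exists>i<n. \<exists>j<n. e = {Inl i, Inr j} \<and> block_colour (row_block a d i) (col_block b j) = c"
      if e: "e \<in> edges (colour_subgraph G f c)" for e
    proof -
      obtain i j where "i < n" "j < n" "e = {Inl i, Inr j}"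
        using e complete_bipartite_edge[of e n] by (auto simp: colour_subgraph_def G_def)
      moreover have "f e = c" using e by (simp add: colour_subgraph_def)
      ultimately show ?thesis using f by metis
    qed
    show "\<forall>e\<in>edges (colour_subgraph G f c). e \<subseteq> verts (colour_subgraph G f c)"
      using edge by (fastforce simp: colour_subgraph_def G_def complete_bipartite_def)
    have lab: "block_label a b d c (Inl i) = block_label a b d c (Inr j)"
      and cov: "Inl i \<in> block_cover a b d c \<or> Inr j \<in> block_cover a b d c"
      if "block_colour (row_block a d i) (col_block b j) = c" for i j
      using that by (auto simp: block_colour_def block_label_def block_cover_def row_block_def col_block_def
          split: if_splits)
    show "\<forall>u v. {u, v} \<in> edges (colour_subgraph G f c) \<longrightarrow> block_label a b d c u = block_label a b d c v"
      using edge lab by (fastforce simp: doubleton_eq_iff)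
    show "\<forall>e\<in>edges (colour_subgraph G f c). e \<inter> block_cover a b d c \<noteq> {}"
      using edge cov by fastforce
    show "\<forall>i. finite {v \<in> verts (colour_subgraph G f c). v \<in> block_cover a b d c \<and> block_label a b d c v = i} \<and>
        card {v \<in> verts (colour_subgraph G f c). v \<in> block_cover a b d c \<and> block_label a b d c v = i} < t c"
    proof
      fix s
      let ?S = "{v \<in> verts (colour_subgraph G f c). v \<in> block_cover a b d c \<and> block_label a b d c v = s}"
      let ?R = "\<lambda>p. Inl ` {i. i < n \<and> row_block a d i = p} :: (nat + nat) set"
      let ?C = "\<lambda>q. Inr ` {j. j < n \<and> col_block b j = q} :: (nat + nat) set"
      have row: "card (?R p) \<le> (if p \<le> 2 then a else d)" for p
      proof -
        let ?U = "(if p = 1 then {..<a} else if p = 2 then {a..<2 * a}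
            else if p = 3 then {2 * a..<2 * a + d} else if p = 4 then {2 * a + d..<2 * a + 2 * d} else {})"
        \<comment> \<open>Block 4 ends by \<open>2 * a + 2 * d = 2 * l + 2 * k - 4\<close>, which is
          at least \<open>k + 2 * m - 3\<close> and so at least \<open>n\<close>.\<close>
        have "{i. i < n \<and> row_block a d i = p} \<subseteq> ?U"
          using klm n by (auto simp: row_block_def a_def d_def split: if_splits)
        then have "card {i. i < n \<and> row_block a d i = p} \<le> card ?U" by (intro card_mono) auto
        also have "\<dots> \<le> (if p \<le> 2 then a else d)" by auto
        finally have "card {i. i < n \<and> row_block a d i = p} \<le> (if p \<le> 2 then a else d)" .
        then show ?thesis by (simp add: card_image)
      qed
      have col: "card (?C q) \<le> (if q \<le> 2 then b else d)" for q
      proof -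
        let ?U = "(if q = 1 then {..<b} else if q = 2 then {b..<2 * b}
            else if q = 3 then {2 * b..<2 * b + d} else {})"
        \<comment> \<open>Block 3 has at most \<open>d\<close> columns because
          \<open>2 * b + d = k + 2 * m - 3\<close>.\<close>
        have "{j. j < n \<and> col_block b j = q} \<subseteq> ?U"
          using klm n by (auto simp: col_block_def b_def d_def split: if_splits)
        then have "card {j. j < n \<and> col_block b j = q} \<le> card ?U" by (intro card_mono) auto
        also have "\<dots> \<le> (if q \<le> 2 then b else d)" by auto
        finally have "card {j. j < n \<and> col_block b j = q} \<le> (if q \<le> 2 then b else d)" .
        then show ?thesis by (simp add: card_image)
      qed
      have "\<exists>U. ?S \<subseteq> U \<and> finite U \<and> card U < t c"
      proof (cases c)
        case Red
        have "?S \<subseteq> (if s = 1 then ?R 4 else if s = 2 then ?R 3 else ?C 3)"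
          by (auto simp: Red block_cover_def block_label_def row_block_def col_block_def colour_subgraph_def
              G_def complete_bipartite_def split: if_splits)
        moreover have "d < t c" using Red klm by (simp add: d_def t_def)
        ultimately show ?thesis using row[of 3] row[of 4] col[of 3] by (intro exI conjI) auto
      next
        case Blue
        have "?S \<subseteq> (if s = 1 then ?R 2 else if s = 2 then ?R 1 else ?C 3)"
          by (auto simp: Blue block_cover_def block_label_def row_block_def col_block_def colour_subgraph_def
              G_def complete_bipartite_def split: if_splits)
        moreover have "a < t c" "d < t c" using Blue klm by (auto simp: a_def d_def t_def)
        ultimately show ?thesis using row[of 1] row[of 2] col[of 3] by (intro exI conjI) auto
      next
        case Green
        have "?S \<subseteq> (if s \<le> 2 then ?C s else {})"
          by (auto simp: Green block_cover_def block_label_def row_block_def col_block_def colour_subgraph_def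
              G_def complete_bipartite_def split: if_splits)
        moreover have "b < t c" using Green klm by (auto simp: b_def t_def)
        ultimately show ?thesis using col[of s] by (intro exI conjI) auto
      qed
      then show "finite ?S \<and> card ?S < t c" using finite_subset card_mono by (meson order.strict_trans1)
    qed
  qed
  show ?thesis
    unfolding bipartite_ramsey_property_def not_all
    using small[of _ Red] small[of _ Blue] small[of _ Green]
    by (intro exI[of _ f]) (auto simp: connected_matching_def t_def G_def not_le[symmetric])
qed

theorem theorem4p1:
  fixes k l m :: nat
  assumes "3 \<le> k" and "k < l" and "l < m" and "real m \<le> real l + (real k - 1) / 2"
  shows "r k l m = k + 2 * m - 2"
  unfolding r_def
proof (rule Least_equality)
  show "bipartite_ramsey_property k l m (k + 2 * m - 2)"
    using assms by (intro bipartite_ramsey_upper) auto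
  \<comment> \<open>The fraction is cleared over the reals before passing to natural numbers with
    truncated subtraction.\<close>
  have "real (2 * m + 1) \<le> real (2 * l + k)" using assms(4) by (simp add: field_simps)
  then have "2 * m \<le> 2 * l + k - 1" unfolding of_nat_le_iff by linarith
  then show "k + 2 * m - 2 \<le> n" if "bipartite_ramsey_property k l m n" for n
    using that bipartite_ramsey_lower[of k l m n] assms by fastforce
qed

end
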